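(* Let $\mathcal{H}$ be a Hopf algebra in $\mathrm{SupLat}$ with co-quasitriangular structure $\mathcal{R}$, and let $r$ be the induced braiding operator on its remnant $R(\mathcal{H})$. The transmuted product on $\mathcal{H}$, $$a\star b=\mathcal{R}\big(S(a_{(2)}),\,b_{(1)}.S(b_{(3)})\big)\,a_{(1)}.b_{(2)},$$ restricts to a secondary group structure on $R(\mathcal{H})$, and this agrees with the $\star$ multiplication induced on $R(\mathcal{H})$ by the braiding operator $r$, namely $x\star y=x.\sigma_x^{-1}(y)$, where $r(x,y)=(\sigma_x(y),\gamma_y(x))$.
   Context: $\mathrm{SupLat}$ is the category whose objects are complete lattices (posets in which every subset $S$ has a join $\vee S$) and whose morphisms are maps preserving arbitrary joins. The least element is denoted $\emptyset$. $\mathcal{L}\otimes\mathcal{M}$ is the complete lattice through which every map $\mathcal{L}\times\mathcal{M}\to\mathcal{K}$ preserving joins separately in each variable factors uniquely as a join-preserving morphism; $(l,m)$ denotes the image of a pair. The unit object is $\mathcal{P}(1)=\{\emptyset,1\}$ (with its multiplication $1.1=1$, other products $\emptyset$), and it acts on any lattice by $1.l=l$, $\emptyset.l=\emptyset$. The symmetry is $(l,m)\mapsto(m,l)$. A Hopf algebra in $\mathrm{SupLat}$ is a complete lattice $\mathcal{H}$ with join-preserving morphisms $m:\mathcal{H}\otimes\mathcal{H}\to\mathcal{H}$ (written $a.b$), $\Delta:\mathcal{H}\to\mathcal{H}\otimes\mathcal{H}$, $\epsilon:\mathcal{H}\to\mathcal{P}(1)$, an element $1\in\mathcal{H}$ and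 an invertible join-preserving morphism $S:\mathcal{H}\to\mathcal{H}$ such that: $m$ is associative with two-sided unit $1$; $(\Delta\otimes\mathrm{id})\Delta=(\mathrm{id}\otimes\Delta)\Delta$ and $(\epsilon\otimes\mathrm{id})\Delta=\mathrm{id}=(\mathrm{id}\otimes\epsilon)\Delta$; $\Delta(1)=(1,1)$, $\epsilon(1)=1$, $\epsilon(h.h')=1$ iff $\epsilon(h)=\epsilon(h')=1$, and $\Delta(h.h')=\Delta(h).\Delta(h')$ componentwise; and $m(\mathrm{id}\otimes S)\Delta(h)=m(S\otimes\mathrm{id})\Delta(h)$ equals $1$ if $\epsilon(h)=1$ and $\emptyset$ otherwise. Sweedler notation: $\Delta(a)=\vee(a_{(1)},a_{(2)})$, iterated coproducts $a_{(1)},a_{(2)},a_{(3)}$, etc.; expressions in Sweedler notation denote the join over all terms. A co-quasitriangular structure on $\mathcal{H}$ is a join-preserving $\mathcal{R}:\mathcal{H}\otimes\mathcal{H}\to\mathcal{P}(1)$ with a join-preserving convolution inverse $\mathcal{R}^{-1}$, i.e. $\mathcal{R}^{-1}(a_{(1)},b_{(1)}).\mathcal{R}(a_{(2)},b_{(2)})=\epsilon(a).\epsilon(b)=\mathcal{R}(a_{(1)},b_{(1)}).\mathcal{R}^{-1}(a_{(2)},b_{(2)})$, such that for all $a,b,c\in\mathcal{H}$: $\mathcal{R}(a.b,c)=\mathcal{R}(b,c_{(1)}).\mathcal{R}(a,c_{(2)})$; $\mathcal{R}(a,b.c)=\mathcal{R}(a_{(1)},b).\mathcal{R}(a_{(2)},c)$;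 $\mathcal{R}(b_{(1)},a_{(1)})\,a_{(2)}.b_{(2)}=b_{(1)}.a_{(1)}\,\mathcal{R}(b_{(2)},a_{(2)})$. Remnant: let $D=\vee\epsilon^{-1}(\emptyset)$, let $\mathcal{Q}$ be the quotient of $\mathcal{H}$ by $h\sim h\vee D$ (ordered by $\overline{a}\le\overline{b}$ iff $a\vee D\le b\vee D$), $\pi:\mathcal{H}\to\mathcal{Q}$, $\pi(h)=\overline{h}$, and $\iota:\mathcal{Q}\to\mathcal{H}$, $\iota(\overline{h})=h\vee D$. $\mathcal{Q}$ has a Hopf algebra structure making $\pi$ a Hopf algebra morphism, and with it $\mathcal{Q}$ is isomorphic to the group algebra $\mathcal{P}(R(\mathcal{H}))$ of a group $R(\mathcal{H})$, the remnant (group algebra of $G$: $\{g\}.\{h\}=\{gh\}$, $\Delta\{g\}=(\{g\},\{g\})$, $\epsilon\{g\}=1$, $S\{g\}=\{g^{-1}\}$). Concretely $R(\mathcal{H})$ consists of the elements $q\neq\emptyset$ of $\mathcal{Q}$ with $\Delta(q)=(q,q)$, with the product of $\mathcal{Q}$. Induced braiding operator: with $\Gamma(a,b)=\mathcal{R}(a_{(1)},b_{(1)}).(b_{(2)},a_{(2)}).\mathcal{R}^{-1}(a_{(3)},b_{(3)})$, the morphism $(\pi\otimes\pi)\Gamma(\iota\otimes\iota)$ on $\mathcal{Q}\otimes\mathcal{Q}\cong\mathcal{P}(R(\mathcal{H})\times R(\mathcal{H}))$ sends singletons to singletons, and $r$ is the resulting map on $R(\mathcal{H})\times R(\mathcal{H})$;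 it is a braiding operator on $R(\mathcal{H})$. A braiding operator on a group $(G,m,e)$ is a map $r:G\times G\to G\times G$ such that for all $f,g,h$: $m\,r(g,h)=g.h$; $r(e,g)=(g,e)$, $r(g,e)=(e,g)$; $r(g.h,f)=(\mathrm{id}\times m)(r\times\mathrm{id})(g,r(h,f))$; $r(g,h.f)=(m\times\mathrm{id})(\mathrm{id}\times r)(r(g,h),f)$. Writing $r(x,y)=(\sigma_x(y),\gamma_y(x))$, each $\sigma_x$ is bijective with $\sigma_x^{-1}=\sigma_{x^{-1}}$, and $x\star y:=x.\sigma_x^{-1}(y)$ is a second group structure on $G$ (making $G$ a skew left brace). "The transmuted product restricts to $R(\mathcal{H})$" means that the product $(x,y)\mapsto\pi(\iota(x)\star\iota(y))$ on $\mathcal{Q}$ maps $R(\mathcal{H})\times R(\mathcal{H})$ into $R(\mathcal{H})$, and the restricted operation is the one considered. *)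

theory Defs
  imports Main "HOL-Algebra.Group"
begin

section \<open>Tensor products of complete lattices\<close>

text \<open>The objects of SupLat are the types of class complete lattice.\<close>

definition join_preserving ::
    "('a::Complete_Lattices.complete_lattice \<Rightarrow> 'b::Complete_Lattices.complete_lattice) \<Rightarrow> bool"
  where "join_preserving f \<longleftrightarrow> (\<forall>A. f (Sup A) = Sup (f ` A))"

definition bi_join_preserving ::
    "('a::Complete_Lattices.complete_lattice \<Rightarrow> 'b::Complete_Lattices.complete_lattice
      \<Rightarrow> 'c::Complete_Lattices.complete_lattice) \<Rightarrow> bool"
  where "bi_join_preserving f \<longleftrightarrow>
    (\<forall>m. join_preserving (\<lambda>l. f l m)) \<and> (\<forall>l. join_preserving (f l))"

text \<open>An element of the tensor product is represented by the set of all pairs whose image lies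
  below it: a down-set of the product order which is closed under joins in each variable
  separately (so that it contains every pair with a bottom component).\<close>

definition bi_ideal ::
    "('a::Complete_Lattices.complete_lattice \<times> 'b::Complete_Lattices.complete_lattice) set \<Rightarrow> bool"
  where "bi_ideal D \<longleftrightarrow>
    (\<forall>l m l' m'. (l, m) \<in> D \<longrightarrow> l' \<le> l \<longrightarrow> m' \<le> m \<longrightarrow> (l', m') \<in> D) \<and>
    (\<forall>A m. (\<forall>l\<in>A. (l, m) \<in> D) \<longrightarrow> (Sup A, m) \<in> D) \<and>
    (\<forall>l B. (\<forall>m\<in>B. (l, m) \<in> D) \<longrightarrow> (l, Sup B) \<in> D)"

lemma bi_ideal_down: "bi_ideal D \<Longrightarrow> (l, m) \<in> D \<Longrightarrow> l' \<le> l \<Longrightarrow> m' \<le> m \<Longrightarrow> (l', m') \<in> D"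
  unfolding bi_ideal_def by meson

lemma bi_ideal_Sup1: "bi_ideal D \<Longrightarrow> (\<And>l. l \<in> A \<Longrightarrow> (l, m) \<in> D) \<Longrightarrow> (Sup A, m) \<in> D"
  unfolding bi_ideal_def by meson

lemma bi_ideal_Sup2: "bi_ideal D \<Longrightarrow> (\<And>m. m \<in> B \<Longrightarrow> (l, m) \<in> D) \<Longrightarrow> (l, Sup B) \<in> D"
  unfolding bi_ideal_def by meson

lemma bi_ideal_Inter: "(\<And>D. D \<in> \<D> \<Longrightarrow> bi_ideal D) \<Longrightarrow> bi_ideal (\<Inter>\<D>)"
  unfolding bi_ideal_def Inter_iff by (intro conjI allI impI ballI; meson)

typedef (overloaded)
  ('a::Complete_Lattices.complete_lattice, 'b::Complete_Lattices.complete_lattice) tensor =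
    "{D :: ('a \<times> 'b) set. bi_ideal D}"
  morphisms terms Abs_tensor
  by (rule exI[of _ UNIV]) (simp add: bi_ideal_def)

setup_lifting type_definition_tensor

lemma bi_ideal_terms: "bi_ideal (terms t)"
  using terms[of t] by simp

instantiation tensor ::
  (Complete_Lattices.complete_lattice, Complete_Lattices.complete_lattice)
  Complete_Lattices.complete_lattice
begin

lift_definition less_eq_tensor :: "('a, 'b) tensor \<Rightarrow> ('a, 'b) tensor \<Rightarrow> bool" is "(\<subseteq>)" .

definition less_tensor :: "('a, 'b) tensor \<Rightarrow> ('a, 'b) tensor \<Rightarrow> bool"
  where "less_tensor s t \<longleftrightarrow> s \<le> t \<and> \<not> t \<le> s"

lift_definition Inf_tensor :: "('a, 'b) tensor set \<Rightarrow> ('a, 'b) tensor" is "\<lambda>T. \<Inter>T"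
  by (blast intro: bi_ideal_Inter)

definition Sup_tensor :: "('a, 'b) tensor set \<Rightarrow> ('a, 'b) tensor"
  where "Sup_tensor T = Inf {u. \<forall>t\<in>T. t \<le> u}"

definition inf_tensor :: "('a, 'b) tensor \<Rightarrow> ('a, 'b) tensor \<Rightarrow> ('a, 'b) tensor"
  where "inf_tensor s t = Inf {s, t}"

definition sup_tensor :: "('a, 'b) tensor \<Rightarrow> ('a, 'b) tensor \<Rightarrow> ('a, 'b) tensor"
  where "sup_tensor s t = Sup {s, t}"

definition top_tensor :: "('a, 'b) tensor" where "top_tensor = Inf {}"

definition bot_tensor :: "('a, 'b) tensor" where "bot_tensor = Sup {}"

instance
proof -
  have refl: "s \<le> s" and trans: "s \<le> t \<Longrightarrow> t \<le> u \<Longrightarrow> s \<le> u"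
    and antisym: "s \<le> t \<Longrightarrow> t \<le> s \<Longrightarrow> s = t" for s t u :: "('a, 'b) tensor"
    by (transfer; blast)+
  have Inf_lower: "s \<in> T \<Longrightarrow> Inf T \<le> s" for s :: "('a, 'b) tensor" and T
    by transfer blast
  have Inf_greatest: "(\<And>t. t \<in> T \<Longrightarrow> s \<le> t) \<Longrightarrow> s \<le> Inf T" for s :: "('a, 'b) tensor" and T
    by transfer blast
  have Sup_upper: "s \<in> T \<Longrightarrow> s \<le> Sup T" for s :: "('a, 'b) tensor" and T
    unfolding Sup_tensor_def by (rule Inf_greatest) blast
  have Sup_least: "(\<And>t. t \<in> T \<Longrightarrow> t \<le> s) \<Longrightarrow> Sup T \<le> s" for s :: "('a, 'b) tensor" and T
    unfolding Sup_tensor_def by (rule Inf_lower) blast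
  show "OFCLASS(('a, 'b) tensor, complete_lattice_class)"
  proof (intro_classes, goal_cases)
    case 1 show ?case by (rule less_tensor_def)
  next
    case 2 show ?case by (rule refl)
  next
    case 3 then show ?case by (rule trans)
  next
    case 4 then show ?case by (rule antisym)
  next
    case 5 show ?case unfolding inf_tensor_def by (rule Inf_lower) simp
  next
    case 6 show ?case unfolding inf_tensor_def by (rule Inf_lower) simp
  next
    case 7 then show ?case unfolding inf_tensor_def by (intro Inf_greatest) auto
  next
    case 8 show ?case unfolding sup_tensor_def by (rule Sup_upper) simp
  next
    case 9 show ?case unfolding sup_tensor_def by (rule Sup_upper) simp
  next
    case 10 then show ?case unfolding sup_tensor_def by (intro Sup_least) auto
  next
    case 11 then show ?case by (rule Inf_lower)
  next
    case 12 then show ?case by (intro Inf_greatest) simp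
  next
    case 13 then show ?case by (rule Sup_upper)
  next
    case 14 then show ?case by (intro Sup_least) simp
  next
    case 15 show ?case by (rule top_tensor_def[symmetric])
  next
    case 16 show ?case by (rule bot_tensor_def[symmetric])
  qed
qed

end

lift_definition pure_tensor :: "'a::Complete_Lattices.complete_lattice \<Rightarrow>
    'b::Complete_Lattices.complete_lattice \<Rightarrow> ('a, 'b) tensor" (infixr "\<boxtimes>" 75)
  is "\<lambda>l m. {(l', m'). l' \<le> l \<and> m' \<le> m \<or> l' = bot \<or> m' = bot}"
  unfolding bi_ideal_def
  apply (intro conjI allI impI)
proof goal_cases
  case (1 a b l1 m1 l2 m2)
  then show ?case by (auto simp: bot_unique dest: order_trans[of l2] order_trans[of m2])
next
  case (2 a b A m')
  show ?case
  proof (cases "m' = bot \<or> (\<exists>l'\<in>A. l' \<noteq> bot)")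
    case True
    with 2 show ?thesis by (auto simp: Sup_le_iff)
  next
    case False
    then have "Sup A = bot" by (auto simp: Sup_bot_conv)
    then show ?thesis by simp
  qed
next
  case (3 a b l' B)
  show ?case
  proof (cases "l' = bot \<or> (\<exists>m'\<in>B. m' \<noteq> bot)")
    case True
    with 3 show ?thesis by (auto simp: Sup_le_iff)
  next
    case False
    then have "Sup B = bot" by (auto simp: Sup_bot_conv)
    then show ?thesis by simp
  qed
qed

lemma pure_tensor_le_iff: "l \<boxtimes> m \<le> t \<longleftrightarrow> (l, m) \<in> terms t"
proof -
  have D: "bi_ideal (terms t)" by (rule bi_ideal_terms)
  have "(Sup {}, m') \<in> terms t" and "(l', Sup {}) \<in> terms t" for l' m'
    by (rule bi_ideal_Sup1[OF D], simp) (rule bi_ideal_Sup2[OF D], simp)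
  then have b: "(bot, m') \<in> terms t" "(l', bot) \<in> terms t" for l' m'
    by auto
  have d: "(l', m') \<in> terms t" if "(l, m) \<in> terms t" "l' \<le> l" "m' \<le> m" for l' m'
    using D that by (rule bi_ideal_down)
  show ?thesis
    unfolding less_eq_tensor.rep_eq pure_tensor.rep_eq using b d by auto
qed

lemma tensor_eq_SUP: "t = (SUP (l, m)\<in>terms t. l \<boxtimes> m)"
proof (rule antisym)
  show "t \<le> (SUP (l, m)\<in>terms t. l \<boxtimes> m)"
    unfolding less_eq_tensor.rep_eq
  proof (clarify)
    fix l m assume "(l, m) \<in> terms t"
    then have "l \<boxtimes> m \<le> (SUP (l, m)\<in>terms t. l \<boxtimes> m)"
      using SUP_upper[of "(l, m)" "terms t" "\<lambda>(l, m). l \<boxtimes> m"] by simp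
    then show "(l, m) \<in> terms (SUP (l, m)\<in>terms t. l \<boxtimes> m)"
      by (simp only: pure_tensor_le_iff)
  qed
  show "(SUP (l, m)\<in>terms t. l \<boxtimes> m) \<le> t"
    by (auto intro!: SUP_least simp: pure_tensor_le_iff)
qed

text \<open>The join-preserving map induced by a map preserving joins in each variable.\<close>

definition tensor_lift :: "('a::Complete_Lattices.complete_lattice \<Rightarrow>
    'b::Complete_Lattices.complete_lattice \<Rightarrow> 'c::Complete_Lattices.complete_lattice) \<Rightarrow>
    ('a, 'b) tensor \<Rightarrow> 'c"
  where "tensor_lift f t = (SUP (l, m)\<in>terms t. f l m)"

lemma join_preserving_mono: "join_preserving f \<Longrightarrow> x \<le> y \<Longrightarrow> f x \<le> f y"
  unfolding join_preserving_def
  by (metis Sup_insert ccpo_Sup_singleton image_empty image_insert le_iff_sup)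

lemma join_preserving_bot: "join_preserving f \<Longrightarrow> f bot = bot"
  unfolding join_preserving_def by (metis Sup_empty image_empty)

lemma bi_join_preserving_pure: "bi_join_preserving (\<boxtimes>)"
proof -
  have D: "bi_ideal (terms t)" for t :: "('a, 'b) tensor" by (rule bi_ideal_terms)
  have 1: "Sup A \<boxtimes> m = (SUP l\<in>A. l \<boxtimes> m)" for A :: "'a set" and m :: 'b
  proof (rule antisym)
    have "(l, m) \<in> terms (SUP l\<in>A. l \<boxtimes> m)" if "l \<in> A" for l
      using that unfolding pure_tensor_le_iff[symmetric] by (rule SUP_upper)
    then show "Sup A \<boxtimes> m \<le> (SUP l\<in>A. l \<boxtimes> m)"
      unfolding pure_tensor_le_iff by (rule bi_ideal_Sup1[OF D])
    show "(SUP l\<in>A. l \<boxtimes> m) \<le> Sup A \<boxtimes> m"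
      by (rule SUP_least, unfold less_eq_tensor.rep_eq pure_tensor.rep_eq)
        (auto dest: Sup_upper2)
  qed
  have 2: "l \<boxtimes> Sup B = (SUP m\<in>B. l \<boxtimes> m)" for l :: 'a and B :: "'b set"
  proof (rule antisym)
    have "(l, m) \<in> terms (SUP m\<in>B. l \<boxtimes> m)" if "m \<in> B" for m
      using that unfolding pure_tensor_le_iff[symmetric] by (rule SUP_upper)
    then show "l \<boxtimes> Sup B \<le> (SUP m\<in>B. l \<boxtimes> m)"
      unfolding pure_tensor_le_iff by (rule bi_ideal_Sup2[OF D])
    show "(SUP m\<in>B. l \<boxtimes> m) \<le> l \<boxtimes> Sup B"
      by (rule SUP_least, unfold less_eq_tensor.rep_eq pure_tensor.rep_eq)
        (auto dest: Sup_upper2)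
  qed
  show ?thesis
    unfolding bi_join_preserving_def join_preserving_def using 1 2 by simp
qed

lemma tensor_lift_pure:
  assumes "bi_join_preserving f"
  shows "tensor_lift f (l \<boxtimes> m) = f l m"
proof (rule antisym)
  have jp: "join_preserving (\<lambda>l. f l m)" "join_preserving (f l)" for l m
    using assms unfolding bi_join_preserving_def by auto
  have mono: "f l' m' \<le> f l m" if "l' \<le> l" "m' \<le> m" for l m l' m'
    using join_preserving_mono[OF jp(1) that(1), of m'] join_preserving_mono[OF jp(2) that(2), of l]
    by (rule order_trans)
  have bot: "f bot m' = bot" "f l' bot = bot" for l' m'
    using join_preserving_bot[OF jp(1), of m'] join_preserving_bot[OF jp(2), of l'] by auto
  show "tensor_lift f (l \<boxtimes> m) \<le> f l m"
    unfolding tensor_lift_def pure_tensor.rep_eq by (auto intro: SUP_least mono simp: bot)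
  show "f l m \<le> tensor_lift f (l \<boxtimes> m)"
    unfolding tensor_lift_def
    by (rule SUP_upper2[of "(l, m)"]) (simp_all add: pure_tensor.rep_eq)
qed

lemma join_preserving_tensor_lift:
  assumes "bi_join_preserving f"
  shows "join_preserving (tensor_lift f)"
  unfolding join_preserving_def
proof (intro allI antisym)
  fix T
  have jp: "join_preserving (\<lambda>l. f l m)" "join_preserving (f l)" for l m
    using assms unfolding bi_join_preserving_def by auto
  have mono: "f l' m' \<le> f l m" if "l' \<le> l" "m' \<le> m" for l l' m m'
    using join_preserving_mono[OF jp(1) that(1), of m'] join_preserving_mono[OF jp(2) that(2), of l]
    by (rule order_trans)
  let ?k = "Sup (tensor_lift f ` T)"
  let ?D = "{(l, m). f l m \<le> ?k}"
  have Sup1: "f (Sup A) m = (SUP l\<in>A. f l m)" and Sup2: "f l (Sup B) = (SUP m\<in>B. f l m)" for A B l m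
    using jp unfolding join_preserving_def by blast+
  have D: "bi_ideal ?D"
  proof -
    have "f l' m' \<le> ?k" if "f l m \<le> ?k" "l' \<le> l" "m' \<le> m" for l m l' m'
      using mono[OF that(2,3)] that(1) by (rule order_trans)
    then show ?thesis
      unfolding bi_ideal_def by (simp add: Sup1 Sup2 SUP_le_iff)
  qed
  have "t \<le> Abs_tensor ?D" if "t \<in> T" for t
  proof -
    have "f l m \<le> ?k" if "(l, m) \<in> terms t" for l m
    proof -
      have "f l m \<le> tensor_lift f t"
        unfolding tensor_lift_def using that by (intro SUP_upper2[of "(l, m)"]) auto
      also have "\<dots> \<le> ?k" using \<open>t \<in> T\<close> by (rule SUP_upper)
      finally show ?thesis .
    qed
    then show ?thesis
      unfolding less_eq_tensor.rep_eq using D by (auto simp: Abs_tensor_inverse)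
  qed
  then have "Sup T \<le> Abs_tensor ?D" by (rule Sup_least)
  then have "terms (Sup T) \<subseteq> ?D"
    unfolding less_eq_tensor.rep_eq using D by (simp add: Abs_tensor_inverse)
  then show "tensor_lift f (Sup T) \<le> ?k"
    unfolding tensor_lift_def[of f "Sup T"] by (auto intro!: SUP_least)
  show "?k \<le> tensor_lift f (Sup T)"
  proof (rule SUP_least)
    fix t assume "t \<in> T"
    then have "terms t \<subseteq> terms (Sup T)"
      using Sup_upper[of t T] by (simp add: less_eq_tensor.rep_eq)
    then show "tensor_lift f t \<le> tensor_lift f (Sup T)"
      unfolding tensor_lift_def by (rule SUP_subset_mono) simp
  qed
qed

theorem tensor_universal_property:
  assumes "bi_join_preserving f"
  shows "\<exists>!F. join_preserving F \<and> (\<forall>l m. F (l \<boxtimes> m) = f l m)"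
proof (rule ex1I[of _ "tensor_lift f"])
  show "join_preserving (tensor_lift f) \<and> (\<forall>l m. tensor_lift f (l \<boxtimes> m) = f l m)"
    using assms by (simp add: join_preserving_tensor_lift tensor_lift_pure)
next
  fix F assume F: "join_preserving F \<and> (\<forall>l m. F (l \<boxtimes> m) = f l m)"
  show "F = tensor_lift f"
  proof
    fix t
    have "F t = F (SUP (l, m)\<in>terms t. l \<boxtimes> m)" by (subst tensor_eq_SUP) (rule refl)
    also have "\<dots> = (SUP (l, m)\<in>terms t. F (l \<boxtimes> m))"
      using F unfolding join_preserving_def by (simp add: image_image case_prod_beta)
    also have "\<dots> = tensor_lift f t" using F by (simp add: tensor_lift_def)
    finally show "F t = tensor_lift f t" .
  qed
qed

definition tensor_map :: "('a::Complete_Lattices.complete_lattice \<Rightarrow>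
    'c::Complete_Lattices.complete_lattice) \<Rightarrow> ('b::Complete_Lattices.complete_lattice \<Rightarrow>
    'd::Complete_Lattices.complete_lattice) \<Rightarrow> ('a, 'b) tensor \<Rightarrow> ('c, 'd) tensor"
  where "tensor_map f g = tensor_lift (\<lambda>l m. f l \<boxtimes> g m)"

definition tensor_assoc :: "(('a::Complete_Lattices.complete_lattice,
    'b::Complete_Lattices.complete_lattice) tensor, 'c::Complete_Lattices.complete_lattice) tensor
    \<Rightarrow> ('a, ('b, 'c) tensor) tensor"
  where "tensor_assoc = tensor_lift (\<lambda>t c. tensor_lift (\<lambda>a b. a \<boxtimes> (b \<boxtimes> c)) t)"

text \<open>The unit object is the two-element lattice of truth values; this is its action.\<close>

definition act :: "bool \<Rightarrow> 'a::Complete_Lattices.complete_lattice \<Rightarrow> 'a"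
  where "act p l = (if p then l else bot)"


section \<open>Hopf algebras in SupLat\<close>

definition tensor_mult :: "(('a::Complete_Lattices.complete_lattice, 'a) tensor \<Rightarrow> 'a) \<Rightarrow>
    ('a, 'a) tensor \<Rightarrow> ('a, 'a) tensor \<Rightarrow> ('a, 'a) tensor"
  where "tensor_mult m s t =
    tensor_lift (\<lambda>a b. tensor_lift (\<lambda>c d. m (a \<boxtimes> c) \<boxtimes> m (b \<boxtimes> d)) t) s"

text \<open>The structure maps are the parameters of a type class, so that the quotient defining the
  remnant can be formed as a type. The axioms are stated separately, because the assumptions of a
  class cannot mention tensor products of its carrier type.\<close>

class hopf_operations = Complete_Lattices.complete_lattice +
  fixes hmult :: "('a, 'a) tensor \<Rightarrow> 'a"
    and hone :: 'a
    and comult :: "'a \<Rightarrow> ('a, 'a) tensor"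
    and counit :: "'a \<Rightarrow> bool"
    and antipode :: "'a \<Rightarrow> 'a"

abbreviation hprod :: "'a::hopf_operations \<Rightarrow> 'a \<Rightarrow> 'a" (infixl "\<cdot>" 80)
  where "a \<cdot> b \<equiv> hmult (a \<boxtimes> b)"

locale hopf_algebra =
  fixes type_of_H :: "'a::hopf_operations itself"
  assumes hmult_join: "join_preserving (hmult :: ('a, 'a) tensor \<Rightarrow> 'a)"
    and comult_join: "join_preserving (comult :: 'a \<Rightarrow> ('a, 'a) tensor)"
    and counit_join: "join_preserving (counit :: 'a \<Rightarrow> bool)"
    and antipode_join: "join_preserving (antipode :: 'a \<Rightarrow> 'a)"
    and antipode_bij: "bij (antipode :: 'a \<Rightarrow> 'a)"
    and hmult_assoc: "\<And>a b c :: 'a. (a \<cdot> b) \<cdot> c = a \<cdot> (b \<cdot> c)"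
    and hmult_hone_left: "\<And>a :: 'a. hone \<cdot> a = a"
    and hmult_hone_right: "\<And>a :: 'a. a \<cdot> hone = a"
    and comult_coassoc: "\<And>a :: 'a.
      tensor_assoc (tensor_map comult id (comult a)) = tensor_map id comult (comult a)"
    and counit_left: "\<And>a :: 'a. tensor_lift act (tensor_map counit id (comult a)) = a"
    and counit_right: "\<And>a :: 'a.
      tensor_lift (\<lambda>b p. act p b) (tensor_map id counit (comult a)) = a"
    and comult_hone: "comult (hone :: 'a) = hone \<boxtimes> hone"
    and counit_hone: "counit (hone :: 'a)"
    and counit_hmult: "\<And>a b :: 'a. counit (a \<cdot> b) \<longleftrightarrow> counit a \<and> counit b"
    and comult_hmult: "\<And>a b :: 'a. comult (a \<cdot> b) = tensor_mult hmult (comult a) (comult b)"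
    and antipode_right: "\<And>a :: 'a.
      hmult (tensor_map id antipode (comult a)) = act (counit a) hone"
    and antipode_left: "\<And>a :: 'a.
      hmult (tensor_map antipode id (comult a)) = act (counit a) hone"

text \<open>Sweedler notation: an expression in the components of an iterated coproduct is the join of
  its values over all terms below that coproduct.\<close>

definition sweedler2 :: "'a::hopf_operations \<Rightarrow> ('a \<times> 'a) set"
  where "sweedler2 a = terms (comult a)"

definition sweedler3 :: "'a::hopf_operations \<Rightarrow> ('a \<times> 'a \<times> 'a) set"
  where "sweedler3 a =
    {(a1, a2, a3). \<exists>b. (b, a3) \<in> sweedler2 a \<and> (a1, a2) \<in> sweedler2 b}"


section \<open>Co-quasitriangular structures\<close>

definition convolution :: "(('a::hopf_operations, 'a) tensor \<Rightarrow> bool) \<Rightarrow> (('a, 'a) tensor \<Rightarrow> bool) \<Rightarrow>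
    'a \<Rightarrow> 'a \<Rightarrow> bool"
  where "convolution F G a b =
    (SUP (a1, a2)\<in>sweedler2 a. SUP (b1, b2)\<in>sweedler2 b. F (a1 \<boxtimes> b1) \<and> G (a2 \<boxtimes> b2))"

text \<open>The convolution inverse of a co-quasitriangular structure is unique, so carrying it as a
  second argument adds no data.\<close>

definition coquasitriangular ::
    "(('a::hopf_operations, 'a) tensor \<Rightarrow> bool) \<Rightarrow> (('a, 'a) tensor \<Rightarrow> bool) \<Rightarrow> bool"
  where "coquasitriangular R Rinv \<longleftrightarrow>
    join_preserving R \<and> join_preserving Rinv \<and>
    (\<forall>a b. convolution Rinv R a b = (counit a \<and> counit b)) \<and>
    (\<forall>a b. convolution R Rinv a b = (counit a \<and> counit b)) \<and>
    (\<forall>a b c. R (a \<cdot> b \<boxtimes> c) =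
       (SUP (c1, c2)\<in>sweedler2 c. R (b \<boxtimes> c1) \<and> R (a \<boxtimes> c2))) \<and>
    (\<forall>a b c. R (a \<boxtimes> b \<cdot> c) =
       (SUP (a1, a2)\<in>sweedler2 a. R (a1 \<boxtimes> b) \<and> R (a2 \<boxtimes> c))) \<and>
    (\<forall>a b. (SUP (a1, a2)\<in>sweedler2 a. SUP (b1, b2)\<in>sweedler2 b.
              act (R (b1 \<boxtimes> a1)) (a2 \<cdot> b2)) =
           (SUP (a1, a2)\<in>sweedler2 a. SUP (b1, b2)\<in>sweedler2 b.
              act (R (b2 \<boxtimes> a2)) (b1 \<cdot> a1)))"

definition transmuted_product ::
    "(('a::hopf_operations, 'a) tensor \<Rightarrow> bool) \<Rightarrow> 'a \<Rightarrow> 'a \<Rightarrow> 'a"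
  where "transmuted_product R a b =
    (SUP (a1, a2)\<in>sweedler2 a. SUP (b1, b2, b3)\<in>sweedler3 b.
       act (R (antipode a2 \<boxtimes> b1 \<cdot> antipode b3)) (a1 \<cdot> b2))"

definition Gamma :: "(('a::hopf_operations, 'a) tensor \<Rightarrow> bool) \<Rightarrow> (('a, 'a) tensor \<Rightarrow> bool) \<Rightarrow>
    'a \<Rightarrow> 'a \<Rightarrow> ('a, 'a) tensor"
  where "Gamma R Rinv a b =
    (SUP (a1, a2, a3)\<in>sweedler3 a. SUP (b1, b2, b3)\<in>sweedler3 b.
       act (R (a1 \<boxtimes> b1) \<and> Rinv (a3 \<boxtimes> b3)) (b2 \<boxtimes> a2))"


section \<open>The remnant\<close>

definition ker_join :: "'a::hopf_operations"
  where "ker_join = Sup {h. \<not> counit h}"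

text \<open>The equivalence relation generated by relating each element \<open>h\<close> to \<open>sup h ker_join\<close>.\<close>

quotient_type (overloaded) 'a remnant_quot = "'a::hopf_operations" /
  "\<lambda>a b. sup a ker_join = sup b ker_join"
  morphisms rep_remnant_quot proj
  by (auto intro!: equivpI reflpI sympI transpI)

lift_definition incl :: "'a::hopf_operations remnant_quot \<Rightarrow> 'a" is "\<lambda>h. sup h ker_join" .

lemma incl_proj: "incl (proj h) = sup h ker_join"
  by transfer simp

lemma proj_incl: "proj (incl q) = q"
  by transfer (simp add: sup_assoc)

instantiation remnant_quot :: (hopf_operations) Complete_Lattices.complete_lattice
begin

lift_definition less_eq_remnant_quot :: "'a remnant_quot \<Rightarrow> 'a remnant_quot \<Rightarrow> bool"
  is "\<lambda>a b. sup a ker_join \<le> sup b ker_join" by simp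

definition less_remnant_quot :: "'a remnant_quot \<Rightarrow> 'a remnant_quot \<Rightarrow> bool"
  where "less_remnant_quot p q \<longleftrightarrow> p \<le> q \<and> \<not> q \<le> p"

definition Inf_remnant_quot :: "'a remnant_quot set \<Rightarrow> 'a remnant_quot"
  where "Inf_remnant_quot A = proj (Inf (incl ` A))"

definition Sup_remnant_quot :: "'a remnant_quot set \<Rightarrow> 'a remnant_quot"
  where "Sup_remnant_quot A = proj (Sup (incl ` A))"

definition inf_remnant_quot :: "'a remnant_quot \<Rightarrow> 'a remnant_quot \<Rightarrow> 'a remnant_quot"
  where "inf_remnant_quot p q = Inf {p, q}"

definition sup_remnant_quot :: "'a remnant_quot \<Rightarrow> 'a remnant_quot \<Rightarrow> 'a remnant_quot"
  where "sup_remnant_quot p q = Sup {p, q}"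

definition top_remnant_quot :: "'a remnant_quot" where "top_remnant_quot = Inf {}"

definition bot_remnant_quot :: "'a remnant_quot" where "bot_remnant_quot = Sup {}"

instance
proof -
  have le: "p \<le> q \<longleftrightarrow> incl p \<le> incl q" for p q :: "'a remnant_quot"
    by transfer simp
  have ker: "ker_join \<le> incl q" for q :: "'a remnant_quot"
    by transfer simp
  have refl: "p \<le> p" and trans: "p \<le> q \<Longrightarrow> q \<le> s \<Longrightarrow> p \<le> s"
    and antisym: "p \<le> q \<Longrightarrow> q \<le> p \<Longrightarrow> p = q" for p q s :: "'a remnant_quot"
    using order_antisym[of "incl p" "incl q"] proj_incl[of p] proj_incl[of q]
    unfolding le by (simp, metis order_trans, metis)
  have Inf_lower: "q \<in> A \<Longrightarrow> Inf A \<le> q" for q :: "'a remnant_quot" and A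
    unfolding le Inf_remnant_quot_def incl_proj by (simp add: ker INF_lower)
  have Inf_greatest: "(\<And>p. p \<in> A \<Longrightarrow> q \<le> p) \<Longrightarrow> q \<le> Inf A" for q :: "'a remnant_quot" and A
    unfolding le Inf_remnant_quot_def incl_proj by (rule le_supI1) (simp add: INF_greatest)
  have Sup_upper: "q \<in> A \<Longrightarrow> q \<le> Sup A" for q :: "'a remnant_quot" and A
    unfolding le Sup_remnant_quot_def incl_proj by (rule le_supI1) (simp add: SUP_upper)
  have Sup_least: "(\<And>p. p \<in> A \<Longrightarrow> p \<le> q) \<Longrightarrow> Sup A \<le> q" for q :: "'a remnant_quot" and A
    unfolding le Sup_remnant_quot_def incl_proj by (simp add: ker SUP_least)
  show "OFCLASS('a remnant_quot, complete_lattice_class)"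
  proof (intro_classes, goal_cases)
    case 1 show ?case by (rule less_remnant_quot_def)
  next
    case 2 show ?case by (rule refl)
  next
    case 3 then show ?case by (rule trans)
  next
    case 4 then show ?case by (rule antisym)
  next
    case 5 show ?case unfolding inf_remnant_quot_def by (rule Inf_lower) simp
  next
    case 6 show ?case unfolding inf_remnant_quot_def by (rule Inf_lower) simp
  next
    case 7 then show ?case unfolding inf_remnant_quot_def by (intro Inf_greatest) auto
  next
    case 8 show ?case unfolding sup_remnant_quot_def by (rule Sup_upper) simp
  next
    case 9 show ?case unfolding sup_remnant_quot_def by (rule Sup_upper) simp
  next
    case 10 then show ?case unfolding sup_remnant_quot_def by (intro Sup_least) auto
  next
    case 11 then show ?case by (rule Inf_lower)
  next
    case 12 then show ?case by (intro Inf_greatest) simp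
  next
    case 13 then show ?case by (rule Sup_upper)
  next
    case 14 then show ?case by (intro Sup_least) simp
  next
    case 15 show ?case by (rule top_remnant_quot_def[symmetric])
  next
    case 16 show ?case by (rule bot_remnant_quot_def[symmetric])
  qed
qed

end

text \<open>Since \<open>proj\<close> is surjective with section \<open>incl\<close>, these are the only product and coproduct on
  the quotient for which \<open>proj\<close> can be a Hopf algebra morphism.\<close>

definition quot_mult :: "'a::hopf_operations remnant_quot \<Rightarrow> 'a remnant_quot \<Rightarrow> 'a remnant_quot"
  where "quot_mult p q = proj (incl p \<cdot> incl q)"

definition quot_comult :: "'a::hopf_operations remnant_quot \<Rightarrow> ('a remnant_quot, 'a remnant_quot) tensor"
  where "quot_comult q = tensor_map proj proj (comult (incl q))"

definition remnant :: "'a::hopf_operations remnant_quot set"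
  where "remnant = {q. q \<noteq> bot \<and> quot_comult q = q \<boxtimes> q}"

text \<open>The value of the induced morphism at the image of a pair. It is given on pairs because
  \<open>incl\<close> alone sends bottom to \<open>ker_join\<close>, and so is not a morphism of SupLat.\<close>

definition quot_braiding :: "(('a::hopf_operations, 'a) tensor \<Rightarrow> bool) \<Rightarrow> (('a, 'a) tensor \<Rightarrow> bool) \<Rightarrow>
    'a remnant_quot \<Rightarrow> 'a remnant_quot \<Rightarrow> ('a remnant_quot, 'a remnant_quot) tensor"
  where "quot_braiding R Rinv x y = tensor_map proj proj (Gamma R Rinv (incl x) (incl y))"

text \<open>A singleton of the set of pairs corresponds to the image of a pair of elements of the
  remnant.\<close>

definition braiding_op :: "(('a::hopf_operations, 'a) tensor \<Rightarrow> bool) \<Rightarrow> (('a, 'a) tensor \<Rightarrow> bool) \<Rightarrow>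
    'a remnant_quot \<times> 'a remnant_quot \<Rightarrow> 'a remnant_quot \<times> 'a remnant_quot"
  where "braiding_op R Rinv = (\<lambda>(x, y). THE uv. uv \<in> remnant \<times> remnant \<and>
    quot_braiding R Rinv x y = fst uv \<boxtimes> snd uv)"

definition sigma :: "('g \<times> 'g \<Rightarrow> 'g \<times> 'g) \<Rightarrow> 'g \<Rightarrow> 'g \<Rightarrow> 'g"
  where "sigma r x y = fst (r (x, y))"

definition braided_star ::
    "'g set \<Rightarrow> ('g \<Rightarrow> 'g \<Rightarrow> 'g) \<Rightarrow> ('g \<times> 'g \<Rightarrow> 'g \<times> 'g) \<Rightarrow> 'g \<Rightarrow> 'g \<Rightarrow> 'g"
  where "braided_star G mul r x y = mul x (inv_into G (sigma r x) y)"

definition quot_star :: "(('a::hopf_operations, 'a) tensor \<Rightarrow> bool) \<Rightarrow>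
    'a remnant_quot \<Rightarrow> 'a remnant_quot \<Rightarrow> 'a remnant_quot"
  where "quot_star R x y = proj (transmuted_product R (incl x) (incl y))"

end

theory Submission
  imports Defs
begin

text \<open>
  Identities that involve \<open>R\<close> are tested against join-preserving maps into the truth values. Such
  functionals on \<open>H\<close>, on \<open>H \<otimes> H\<close> and on \<open>H \<otimes> H \<otimes> H\<close> form monoids under convolution, and \<open>R\<close> is
  an invertible element of the second of them.

  In the quotient that defines the remnant only the bottom element has counit \<open>False\<close>. This makes
  the unit an atom (\<open>quot_one_atom\<close>), and then the antipode law forces the two components of any
  term of a coproduct with nonzero components to be equal and invertible (\<open>sw_diagonal\<close>). So the
  remnant is the group of invertible elements of the quotient, its elements are atoms, and every
  element is a join of them. Each \<open>g\<close> in the remnant thus gives a character \<open>\<chi> g\<close> of \<open>H\<close>,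
  which tells whether \<open>g\<close> lies below the class of its argument. Under convolution these
  characters are orthogonal idempotents with join the counit.

  A functional on \<open>H \<otimes> H\<close> below \<open>counit \<otimes> counit\<close> is therefore a set of pairs of remnant elements,
  and convolution of such functionals is intersection. Conjugation by \<open>R\<close> preserves joins,
  intersections and the set of all pairs, and so pulls subsets back along a map on pairs
  (\<open>transport_ex1\<close>); up to exchanging the two components of its value, this map is the braiding
  operator \<open>(x, y) \<mapsto> (\<sigma> x y, \<gamma> x y)\<close>. The multiplicativity
  axioms of \<open>R\<close> factor the functionals \<open>R(a.b, c)\<close> and \<open>R(a, b.c)\<close> on three factors as convolution products of two
  copies of \<open>R\<close>. Conjugating characters in two steps gives \<open>\<sigma>_action\<close> and
  \<open>\<sigma>_hexagon\<close>, and braided commutativity gives \<open>\<sigma>_\<gamma>_product\<close>.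

  Finally \<open>Rinv(a, b) = R(a, S b)\<close>. Hence a character applied to \<open>b\<^sub>2\<close> in
  \<open>R(S a\<^sub>2, b\<^sub>1 . S b\<^sub>3) b\<^sub>2\<close> gives a conjugated character, evaluated at \<open>S a\<^sub>2\<close> and \<open>b\<close>, and the
  transmuted product becomes \<open>x . \<sigma> (inv x) y\<close> on the remnant (\<open>quot_star_eq\<close>). As \<open>\<sigma>\<close> is an action,
  \<open>\<sigma> (inv x)\<close> inverts \<open>\<sigma> x\<close>, and the usual argument for skew braces shows that this is a
  group law.
\<close>

section \<open>Convolution of two-valued functionals\<close>

text \<open>Coproducts enter through the relation of their terms: \<open>(b, c) \<in> sp a\<close> stands for the pair
  \<open>b \<otimes> c\<close> lying below the coproduct of \<open>a\<close>. For functionals with values in the truth values, the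
  join over all terms in Sweedler notation is then an existential quantifier.\<close>

definition conv :: "('x \<Rightarrow> bool) \<Rightarrow> ('x \<Rightarrow> ('x \<times> 'x) set) \<Rightarrow> ('x \<Rightarrow> bool) \<Rightarrow> 'x \<Rightarrow> bool"
    ("(_/ \<star>\<^bsub>_\<^esub> _)" [70, 0, 71] 70)
  where "F \<star>\<^bsub>sp\<^esub> G = (\<lambda>a. \<exists>b c. (b, c) \<in> sp a \<and> F b \<and> G c)"

text \<open>A coalgebra seen only through a class \<open>J\<close> of functionals. Coassociativity is demanded only
  after applying functionals: iterated coproducts, bracketed in two ways, may have different sets
  of terms, which only become equal when closed under joins. In this form a product of two
  coalgebras is just a product of relations, and no tensor product of lattices has to be built.

  The set \<open>Pt\<close> plays the role of the group-like elements, \<open>\<chi> p\<close> that of the functional dual to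
  \<open>p\<close>. The last axiom says that the functionals below the counit are the sets of points.\<close>

locale functional_coalgebra =
  fixes sp :: "'x \<Rightarrow> ('x \<times> 'x) set"
    and \<epsilon> :: "'x \<Rightarrow> bool"
    and J :: "('x \<Rightarrow> bool) set"
    and Pt :: "'p set"
    and \<chi> :: "'p \<Rightarrow> 'x \<Rightarrow> bool"
    and rep :: "'p \<Rightarrow> 'x"
  assumes J_Bex: "\<And>\<F>. \<F> \<subseteq> J \<Longrightarrow> (\<lambda>x. \<exists>F\<in>\<F>. F x) \<in> J"
    and J_eps: "\<epsilon> \<in> J"
    and J_split: "\<And>f. (\<And>b. (\<lambda>a. f a b) \<in> J) \<Longrightarrow> (\<And>a. f a \<in> J) \<Longrightarrow>
      (\<lambda>x. \<exists>a b. (a, b) \<in> sp x \<and> f a b) \<in> J"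
    and coassoc: "\<And>T h. (\<And>b c. (\<lambda>a. T a b c) \<in> J) \<Longrightarrow> (\<And>a c. (\<lambda>b. T a b c) \<in> J) \<Longrightarrow>
      (\<And>a b. T a b \<in> J) \<Longrightarrow>
      (\<exists>x c. (x, c) \<in> sp h \<and> (\<exists>a b. (a, b) \<in> sp x \<and> T a b c)) \<longleftrightarrow>
      (\<exists>a x. (a, x) \<in> sp h \<and> (\<exists>b c. (b, c) \<in> sp x \<and> T a b c))"
    and counit_l: "\<And>F a. F \<in> J \<Longrightarrow> (\<exists>b c. (b, c) \<in> sp a \<and> \<epsilon> b \<and> F c) \<longleftrightarrow> F a"
    and counit_r: "\<And>F a. F \<in> J \<Longrightarrow> (\<exists>b c. (b, c) \<in> sp a \<and> F b \<and> \<epsilon> c) \<longleftrightarrow> F a"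
    and J_chi: "\<And>p. p \<in> Pt \<Longrightarrow> \<chi> p \<in> J"
    and chi_split: "\<And>p q a. p \<in> Pt \<Longrightarrow> q \<in> Pt \<Longrightarrow>
      (\<exists>b c. (b, c) \<in> sp a \<and> \<chi> p b \<and> \<chi> q c) \<longleftrightarrow> p = q \<and> \<chi> p a"
    and chi_rep: "\<And>p q. p \<in> Pt \<Longrightarrow> q \<in> Pt \<Longrightarrow> \<chi> p (rep q) \<longleftrightarrow> p = q"
    and eps_chi: "\<And>a. \<epsilon> a \<longleftrightarrow> (\<exists>p\<in>Pt. \<chi> p a)"
    and below_eps: "\<And>F a. F \<in> J \<Longrightarrow> (\<And>b. F b \<Longrightarrow> \<epsilon> b) \<Longrightarrow> F a \<longleftrightarrow> (\<exists>p\<in>Pt. \<chi> p a \<and> F (rep p))"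
begin

lemma J_Ex: "(\<And>i. i \<in> I \<Longrightarrow> F i \<in> J) \<Longrightarrow> (\<lambda>x. \<exists>i\<in>I. F i x) \<in> J"
  using J_Bex[of "F ` I"] by (simp add: image_subset_iff)

lemma J_and: "F \<in> J \<Longrightarrow> (\<lambda>x. P \<and> F x) \<in> J" "F \<in> J \<Longrightarrow> (\<lambda>x. F x \<and> P) \<in> J"
  using J_Ex[of "{u :: unit. P}" "\<lambda>_. F"] by (cases P; simp)+

lemma J_conv: "F \<in> J \<Longrightarrow> G \<in> J \<Longrightarrow> F \<star>\<^bsub>sp\<^esub> G \<in> J"
  unfolding conv_def by (rule J_split) (auto intro: J_and)

lemma conv_assoc:
  assumes "F \<in> J" "G \<in> J" "K \<in> J"
  shows "F \<star>\<^bsub>sp\<^esub> G \<star>\<^bsub>sp\<^esub> K = F \<star>\<^bsub>sp\<^esub> (G \<star>\<^bsub>sp\<^esub> K)"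
proof
  fix h
  have "(F \<star>\<^bsub>sp\<^esub> G \<star>\<^bsub>sp\<^esub> K) h \<longleftrightarrow> (\<exists>x c. (x, c) \<in> sp h \<and> (\<exists>a b. (a, b) \<in> sp x \<and> (F a \<and> G b \<and> K c)))"
    unfolding conv_def by blast
  also have "\<dots> \<longleftrightarrow> (\<exists>a x. (a, x) \<in> sp h \<and> (\<exists>b c. (b, c) \<in> sp x \<and> (F a \<and> G b \<and> K c)))"
    by (rule coassoc) (intro J_and assms)+
  also have "\<dots> \<longleftrightarrow> (F \<star>\<^bsub>sp\<^esub> (G \<star>\<^bsub>sp\<^esub> K)) h"
    unfolding conv_def by blast
  finally show "(F \<star>\<^bsub>sp\<^esub> G \<star>\<^bsub>sp\<^esub> K) h \<longleftrightarrow> (F \<star>\<^bsub>sp\<^esub> (G \<star>\<^bsub>sp\<^esub> K)) h" .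
qed

lemma conv_eps: "F \<in> J \<Longrightarrow> \<epsilon> \<star>\<^bsub>sp\<^esub> F = F" "F \<in> J \<Longrightarrow> F \<star>\<^bsub>sp\<^esub> \<epsilon> = F"
  unfolding conv_def using counit_l counit_r by auto

lemma conj_Ex:
  "(U \<star>\<^bsub>sp\<^esub> (\<lambda>x. \<exists>i\<in>I. F i x) \<star>\<^bsub>sp\<^esub> V) a \<longleftrightarrow> (\<exists>i\<in>I. (U \<star>\<^bsub>sp\<^esub> F i \<star>\<^bsub>sp\<^esub> V) a)"
  unfolding conv_def by blast

lemma inverse_unique:
  assumes "U \<in> J" "V \<in> J" "W \<in> J" "V \<star>\<^bsub>sp\<^esub> U = \<epsilon>" "U \<star>\<^bsub>sp\<^esub> W = \<epsilon>"
  shows "V = W"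
  by (metis assms conv_assoc conv_eps)

text \<open>Conjugation by a product is done in two steps, inner factor first. So the two factors of
  \<open>R(a.b, c)\<close>, and those of \<open>R(a, b.c)\<close>, act one after the other.\<close>

lemma conj_conj:
  assumes "U1 \<in> J" "U2 \<in> J" "V1 \<in> J" "V2 \<in> J" "F \<in> J"
  shows "U1 \<star>\<^bsub>sp\<^esub> U2 \<star>\<^bsub>sp\<^esub> F \<star>\<^bsub>sp\<^esub> (V2 \<star>\<^bsub>sp\<^esub> V1) = U1 \<star>\<^bsub>sp\<^esub> (U2 \<star>\<^bsub>sp\<^esub> F \<star>\<^bsub>sp\<^esub> V2) \<star>\<^bsub>sp\<^esub> V1"
  by (simp add: assms conv_assoc J_conv)

lemma inverse_mult:
  assumes "U1 \<in> J" "U2 \<in> J" "V1 \<in> J" "V2 \<in> J" "U1 \<star>\<^bsub>sp\<^esub> V1 = \<epsilon>" "U2 \<star>\<^bsub>sp\<^esub> V2 = \<epsilon>"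
  shows "U1 \<star>\<^bsub>sp\<^esub> U2 \<star>\<^bsub>sp\<^esub> (V2 \<star>\<^bsub>sp\<^esub> V1) = \<epsilon>"
  by (metis assms conv_assoc J_conv conv_eps)

end

locale conv_invertible = functional_coalgebra sp \<epsilon> J Pt \<chi> rep
  for sp :: "'x \<Rightarrow> ('x \<times> 'x) set" and \<epsilon> J and Pt :: "'p set" and \<chi> rep +
  fixes U V :: "'x \<Rightarrow> bool"
  assumes U: "U \<in> J" and V: "V \<in> J" and UV: "U \<star>\<^bsub>sp\<^esub> V = \<epsilon>" and VU: "V \<star>\<^bsub>sp\<^esub> U = \<epsilon>"
begin

text \<open>Conjugation by \<open>U\<close> is an automorphism of the algebra of functionals below \<open>\<epsilon>\<close>, that is, of
  sets of points. So it takes the singleton of a point \<open>q\<close> to a preimage of \<open>q\<close>, under a map of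
  points which is \<open>transport\<close>.\<close>

definition transport :: "'p \<Rightarrow> 'p"
  where "transport p = (THE q. q \<in> Pt \<and> (U \<star>\<^bsub>sp\<^esub> \<chi> q \<star>\<^bsub>sp\<^esub> V) (rep p))"

lemma conj_below_eps:
  assumes "q \<in> Pt" "(U \<star>\<^bsub>sp\<^esub> \<chi> q \<star>\<^bsub>sp\<^esub> V) a"
  shows "\<epsilon> a"
proof -
  have "(U \<star>\<^bsub>sp\<^esub> \<epsilon> \<star>\<^bsub>sp\<^esub> V) a"
    using assms eps_chi unfolding conv_def by blast
  then show ?thesis by (simp add: conv_eps U UV)
qed

text \<open>A point lies in some conjugated singleton, because these have join \<open>U \<star> \<epsilon> \<star> V = \<epsilon>\<close>. It lies in
  only one, because conjugation is multiplicative and different singletons have convolution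
  \<open>False\<close>.\<close>

lemma transport_ex1:
  assumes "p \<in> Pt"
  shows "\<exists>!q. q \<in> Pt \<and> (U \<star>\<^bsub>sp\<^esub> \<chi> q \<star>\<^bsub>sp\<^esub> V) (rep p)"
proof -
  have "\<epsilon> (rep p)" using assms eps_chi chi_rep by blast
  then have "(U \<star>\<^bsub>sp\<^esub> \<epsilon> \<star>\<^bsub>sp\<^esub> V) (rep p)" by (simp add: conv_eps U UV)
  then have ex: "\<exists>q. q \<in> Pt \<and> (U \<star>\<^bsub>sp\<^esub> \<chi> q \<star>\<^bsub>sp\<^esub> V) (rep p)"
    unfolding conv_def eps_chi by blast
  have "q = q'" if q: "q \<in> Pt" "(U \<star>\<^bsub>sp\<^esub> \<chi> q \<star>\<^bsub>sp\<^esub> V) (rep p)"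
    and q': "q' \<in> Pt" "(U \<star>\<^bsub>sp\<^esub> \<chi> q' \<star>\<^bsub>sp\<^esub> V) (rep p)" for q q'
  proof -
    let ?F = "U \<star>\<^bsub>sp\<^esub> \<chi> q \<star>\<^bsub>sp\<^esub> V" and ?F' = "U \<star>\<^bsub>sp\<^esub> \<chi> q' \<star>\<^bsub>sp\<^esub> V"
    have J: "\<chi> q \<in> J" "\<chi> q' \<in> J" using J_chi q(1) q'(1) by blast+
    \<comment> \<open>Both functionals hold at the point \<open>p\<close>, hence so does their convolution.\<close>
    obtain b c where bc: "(b, c) \<in> sp (rep p)" "\<chi> p b" "\<chi> p c"
      using chi_split[of p p "rep p"] chi_rep[of p p] assms by blast
    have "?F b"
      using below_eps[of ?F b] conj_below_eps[OF q(1)] bc q(2) assms J U V J_conv by blast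
    moreover have "?F' c"
      using below_eps[of ?F' c] conj_below_eps[OF q'(1)] bc q'(2) assms J U V J_conv by blast
    ultimately have "(?F \<star>\<^bsub>sp\<^esub> ?F') (rep p)"
      using bc(1) unfolding conv_def by blast
    then obtain x where "(?F \<star>\<^bsub>sp\<^esub> ?F') x" by blast
    moreover have "?F \<star>\<^bsub>sp\<^esub> ?F' = U \<star>\<^bsub>sp\<^esub> (\<chi> q \<star>\<^bsub>sp\<^esub> \<chi> q') \<star>\<^bsub>sp\<^esub> V"
      by (metis J J_conv U V VU conv_assoc conv_eps(1))
    ultimately have "(U \<star>\<^bsub>sp\<^esub> (\<chi> q \<star>\<^bsub>sp\<^esub> \<chi> q') \<star>\<^bsub>sp\<^esub> V) x" by simp
    then have "\<exists>x. (\<chi> q \<star>\<^bsub>sp\<^esub> \<chi> q') x"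
      unfolding conv_def[of _ sp V] conv_def[of U sp] by blast
    then show ?thesis
      using chi_split[OF q(1) q'(1)] unfolding conv_def by blast
  qed
  with ex show ?thesis by blast
qed

lemma transport_in: "p \<in> Pt \<Longrightarrow> transport p \<in> Pt"
  unfolding transport_def using theI'[OF transport_ex1] by blast

lemma conj_rep_iff: "p \<in> Pt \<Longrightarrow> q \<in> Pt \<Longrightarrow> (U \<star>\<^bsub>sp\<^esub> \<chi> q \<star>\<^bsub>sp\<^esub> V) (rep p) \<longleftrightarrow> transport p = q"
  unfolding transport_def using theI'[OF transport_ex1] transport_ex1 by blast

lemma conj_chi:
  assumes "q \<in> Pt"
  shows "(U \<star>\<^bsub>sp\<^esub> \<chi> q \<star>\<^bsub>sp\<^esub> V) a \<longleftrightarrow> (\<exists>p\<in>Pt. \<chi> p a \<and> transport p = q)"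
  using below_eps[of "U \<star>\<^bsub>sp\<^esub> \<chi> q \<star>\<^bsub>sp\<^esub> V" a] conj_below_eps assms conj_rep_iff J_conv J_chi U V by auto

end

definition prod_split ::
    "('x \<Rightarrow> ('x \<times> 'x) set) \<Rightarrow> ('y \<Rightarrow> ('y \<times> 'y) set) \<Rightarrow> 'x \<times> 'y \<Rightarrow> (('x \<times> 'y) \<times> ('x \<times> 'y)) set"
  where "prod_split sp sp' = (\<lambda>(a, b).
    {((a1, b1), (a2, b2)) | a1 a2 b1 b2. (a1, a2) \<in> sp a \<and> (b1, b2) \<in> sp' b})"

definition prod_functionals ::
    "('x \<Rightarrow> bool) set \<Rightarrow> ('y \<Rightarrow> bool) set \<Rightarrow> ('x \<times> 'y \<Rightarrow> bool) set"
  where "prod_functionals J J' =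
    {F. (\<forall>b. (\<lambda>a. F (a, b)) \<in> J) \<and> (\<forall>a. (\<lambda>b. F (a, b)) \<in> J')}"

definition prod_fun :: "('x \<Rightarrow> bool) \<Rightarrow> ('y \<Rightarrow> bool) \<Rightarrow> 'x \<times> 'y \<Rightarrow> bool"
  where "prod_fun F G = (\<lambda>(a, b). F a \<and> G b)"

lemma conv_prod_split:
  "(F \<star>\<^bsub>prod_split sp sp'\<^esub> G) (a, b) \<longleftrightarrow>
    (\<exists>a1 a2. (a1, a2) \<in> sp a \<and> (\<exists>b1 b2. (b1, b2) \<in> sp' b \<and> F (a1, b1) \<and> G (a2, b2)))"
  unfolding conv_def prod_split_def by auto

text \<open>Each axiom is checked in one factor at a time, with the arguments from the other factor held
  fixed; this is why the functionals of a product are the maps that are functionals in each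
  variable separately.\<close>

lemma functional_coalgebra_prod:
  assumes "functional_coalgebra sp \<epsilon> J Pt \<chi> rep"
    and "functional_coalgebra sp' \<epsilon>' J' Pt' \<chi>' rep'"
  shows "functional_coalgebra (prod_split sp sp') (prod_fun \<epsilon> \<epsilon>') (prod_functionals J J')
    (Pt \<times> Pt') (\<lambda>(p, q). prod_fun (\<chi> p) (\<chi>' q)) (map_prod rep rep')"
proof -
  interpret A: functional_coalgebra sp \<epsilon> J Pt \<chi> rep by fact
  interpret B: functional_coalgebra sp' \<epsilon>' J' Pt' \<chi>' rep' by fact
  have JJ: "F \<in> prod_functionals J J' \<longleftrightarrow> (\<forall>b. (\<lambda>a. F (a, b)) \<in> J) \<and> (\<forall>a. (\<lambda>b. F (a, b)) \<in> J')" for F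
    by (simp add: prod_functionals_def)
  have ex_split: "(\<exists>u v. (u, v) \<in> prod_split sp sp' (a, b) \<and> f u v) \<longleftrightarrow>
    (\<exists>a1 a2. (a1, a2) \<in> sp a \<and> (\<exists>b1 b2. (b1, b2) \<in> sp' b \<and> f (a1, b1) (a2, b2)))" for f a b
    unfolding prod_split_def by auto
  have JEx_A: "(\<And>i. F i \<in> J) \<Longrightarrow> (\<lambda>x. \<exists>i. Q i \<and> F i x) \<in> J" for Q F
    using A.J_Ex[of "Collect Q" F] by simp
  have JEx_B: "(\<And>i. F i \<in> J') \<Longrightarrow> (\<lambda>x. \<exists>i. Q i \<and> F i x) \<in> J'" for Q F
    using B.J_Ex[of "Collect Q" F] by simp
  have JEx2_A: "(\<And>i j. F i j \<in> J) \<Longrightarrow> (\<lambda>x. \<exists>i j. Q i j \<and> F i j x) \<in> J" for Q and F :: "'i \<Rightarrow> 'j \<Rightarrow> _"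
    using JEx_A[of "\<lambda>(i, j). F i j" "\<lambda>(i, j). Q i j"] by (simp add: case_prod_beta)
  have JEx2_B: "(\<And>i j. F i j \<in> J') \<Longrightarrow> (\<lambda>x. \<exists>i j. Q i j \<and> F i j x) \<in> J'" for Q and F :: "'i \<Rightarrow> 'j \<Rightarrow> _"
    using JEx_B[of "\<lambda>(i, j). F i j" "\<lambda>(i, j). Q i j"] by (simp add: case_prod_beta)
  show ?thesis
  proof (unfold_locales, goal_cases)
    case (1 \<F>)
    then show ?case using A.J_Ex[of \<F>] B.J_Ex[of \<F>] by (auto simp: JJ subset_iff)
  next
    case 2
    show ?case by (auto simp: JJ prod_fun_def intro: A.J_and B.J_and A.J_eps B.J_eps)
  next
    case (3 f)
    then have f: "(\<lambda>a. f (a, b) v) \<in> J" "(\<lambda>b. f (a, b) v) \<in> J'"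
      "(\<lambda>a. f v (a, b)) \<in> J" "(\<lambda>b. f v (a, b)) \<in> J'" for a b v
      unfolding JJ by blast+
    have "(\<lambda>a. \<exists>a1 a2. (a1, a2) \<in> sp a \<and> (\<exists>b1 b2. (b1, b2) \<in> sp' b \<and> f (a1, b1) (a2, b2))) \<in> J" for b
      by (rule A.J_split; rule JEx2_A; rule f)
    moreover have "(\<lambda>b. \<exists>a1 a2. (a1, a2) \<in> sp a \<and> (\<exists>b1 b2. (b1, b2) \<in> sp' b \<and> f (a1, b1) (a2, b2))) \<in> J'" for a
      by (rule JEx2_B, rule B.J_split; rule f)
    ultimately show ?case unfolding JJ ex_split by blast
  next
    case (4 T h)
    obtain a b where h: "h = (a, b)" by (cases h)
    have T: "(\<lambda>a. T (a, b) v w) \<in> J" "(\<lambda>b. T (a, b) v w) \<in> J'"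
      "(\<lambda>a. T v (a, b) w) \<in> J" "(\<lambda>b. T v (a, b) w) \<in> J'"
      "(\<lambda>a. T v w (a, b)) \<in> J" "(\<lambda>b. T v w (a, b)) \<in> J'" for a b v w
      using 4 unfolding JJ by blast+
    have "(\<exists>x c. (x, c) \<in> prod_split sp sp' h \<and> (\<exists>a b. (a, b) \<in> prod_split sp sp' x \<and> T a b c)) \<longleftrightarrow>
      (\<exists>y b3. (y, b3) \<in> sp' b \<and> (\<exists>b1 b2. (b1, b2) \<in> sp' y \<and>
        (\<exists>x a3. (x, a3) \<in> sp a \<and> (\<exists>a1 a2. (a1, a2) \<in> sp x \<and> T (a1, b1) (a2, b2) (a3, b3)))))"
      unfolding h ex_split by blast
    also have "\<dots> \<longleftrightarrow> (\<exists>y b3. (y, b3) \<in> sp' b \<and> (\<exists>b1 b2. (b1, b2) \<in> sp' y \<and>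
        (\<exists>a1 x. (a1, x) \<in> sp a \<and> (\<exists>a2 a3. (a2, a3) \<in> sp x \<and> T (a1, b1) (a2, b2) (a3, b3)))))"
      by (subst A.coassoc) (simp_all add: T)
    also have "\<dots> \<longleftrightarrow> (\<exists>b1 y. (b1, y) \<in> sp' b \<and> (\<exists>b2 b3. (b2, b3) \<in> sp' y \<and>
        (\<exists>a1 x. (a1, x) \<in> sp a \<and> (\<exists>a2 a3. (a2, a3) \<in> sp x \<and> T (a1, b1) (a2, b2) (a3, b3)))))"
      by (rule B.coassoc; intro JEx2_B; rule T)
    also have "\<dots> \<longleftrightarrow> (\<exists>a x. (a, x) \<in> prod_split sp sp' h \<and> (\<exists>b c. (b, c) \<in> prod_split sp sp' x \<and> T a b c))"
      unfolding h ex_split by blast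
    finally show ?case .
  next
    case (5 F h)
    obtain a b where h: "h = (a, b)" by (cases h)
    have F: "(\<lambda>a. F (a, b)) \<in> J" "(\<lambda>b. F (a, b)) \<in> J'" for a b using 5 unfolding JJ by blast+
    have "(\<exists>u v. (u, v) \<in> prod_split sp sp' h \<and> prod_fun \<epsilon> \<epsilon>' u \<and> F v) \<longleftrightarrow>
      (\<exists>a1 a2. (a1, a2) \<in> sp a \<and> \<epsilon> a1 \<and> (\<exists>b1 b2. (b1, b2) \<in> sp' b \<and> \<epsilon>' b1 \<and> F (a2, b2)))"
      unfolding h ex_split prod_fun_def by auto
    also have "\<dots> \<longleftrightarrow> F h"
      by (simp add: B.counit_l[OF F(2)] A.counit_l[OF F(1)] h)
    finally show ?case .
  next
    case (6 F h)
    obtain a b where h: "h = (a, b)" by (cases h)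
    have F: "(\<lambda>a. F (a, b)) \<in> J" "(\<lambda>b. F (a, b)) \<in> J'" for a b using 6 unfolding JJ by blast+
    have "(\<exists>u v. (u, v) \<in> prod_split sp sp' h \<and> F u \<and> prod_fun \<epsilon> \<epsilon>' v) \<longleftrightarrow>
      (\<exists>a1 a2. (a1, a2) \<in> sp a \<and> (\<exists>b1 b2. (b1, b2) \<in> sp' b \<and> F (a1, b1) \<and> \<epsilon>' b2) \<and> \<epsilon> a2)"
      unfolding h ex_split prod_fun_def by auto
    also have "\<dots> \<longleftrightarrow> F h"
      by (simp add: B.counit_r[OF F(2)] A.counit_r[OF F(1)] h)
    finally show ?case .
  next
    case (7 p)
    then show ?case by (auto simp: JJ prod_fun_def intro: A.J_and B.J_and A.J_chi B.J_chi)
  next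
    case (8 p q h)
    obtain a b p1 p2 q1 q2 where e: "h = (a, b)" "p = (p1, p2)" "q = (q1, q2)" by (cases h, cases p, cases q)
    have "(\<exists>u v. (u, v) \<in> prod_split sp sp' h \<and> (case p of (p, q) \<Rightarrow> prod_fun (\<chi> p) (\<chi>' q)) u \<and>
        (case q of (p, q) \<Rightarrow> prod_fun (\<chi> p) (\<chi>' q)) v) \<longleftrightarrow>
      (\<exists>a1 a2. (a1, a2) \<in> sp a \<and> \<chi> p1 a1 \<and> \<chi> q1 a2) \<and>
      (\<exists>b1 b2. (b1, b2) \<in> sp' b \<and> \<chi>' p2 b1 \<and> \<chi>' q2 b2)"
      unfolding e ex_split prod_fun_def by auto
    also have "\<dots> \<longleftrightarrow> p = q \<and> (case p of (p, q) \<Rightarrow> prod_fun (\<chi> p) (\<chi>' q)) h"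
      using 8 unfolding e by (auto simp: A.chi_split B.chi_split prod_fun_def)
    finally show ?case .
  next
    case (9 p q)
    then show ?case by (auto simp: prod_fun_def A.chi_rep B.chi_rep)
  next
    case (10 h)
    then show ?case by (cases h) (auto simp: prod_fun_def A.eps_chi B.eps_chi)
  next
    case (11 F h)
    obtain a b where h: "h = (a, b)" by (cases h)
    have F: "(\<lambda>a. F (a, b)) \<in> J" "(\<lambda>b. F (a, b)) \<in> J'" for a b using 11 unfolding JJ by blast+
    have e: "F (a, b) \<Longrightarrow> \<epsilon> a" "F (a, b) \<Longrightarrow> \<epsilon>' b" for a b
      using 11(2)[of "(a, b)"] by (auto simp: prod_fun_def)
    have "F (a, b) \<longleftrightarrow> (\<exists>p\<in>Pt. \<chi> p a \<and> F (rep p, b))"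
      by (rule A.below_eps[OF F(1)]) (rule e)
    also have "\<dots> \<longleftrightarrow> (\<exists>p\<in>Pt. \<chi> p a \<and> (\<exists>q\<in>Pt'. \<chi>' q b \<and> F (rep p, rep' q)))"
      by (subst B.below_eps[OF F(2)]) (auto intro: e)
    finally show ?case unfolding h by (auto simp: prod_fun_def)
  qed
qed

lemma prod_fun_apply: "prod_fun F G (a, b) \<longleftrightarrow> F a \<and> G b"
  by (simp add: prod_fun_def)

lemma conv_prod_split3:
  "(F \<star>\<^bsub>prod_split sp (prod_split sp' sp'')\<^esub> G) (a, b, c) \<longleftrightarrow>
    (\<exists>a1 a2. (a1, a2) \<in> sp a \<and> (\<exists>b1 b2. (b1, b2) \<in> sp' b \<and> (\<exists>c1 c2. (c1, c2) \<in> sp'' c \<and>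
      F (a1, b1, c1) \<and> G (a2, b2, c2))))"
  unfolding conv_prod_split by (simp add: prod_split_def) blast

lemma conv_prod_fun:
  "prod_fun f F \<star>\<^bsub>prod_split sp sp'\<^esub> prod_fun f' F' = prod_fun (f \<star>\<^bsub>sp\<^esub> f') (F \<star>\<^bsub>sp'\<^esub> F')"
proof (rule ext, clarify)
  fix a b
  show "(prod_fun f F \<star>\<^bsub>prod_split sp sp'\<^esub> prod_fun f' F') (a, b) =
    prod_fun (f \<star>\<^bsub>sp\<^esub> f') (F \<star>\<^bsub>sp'\<^esub> F') (a, b)"
    unfolding conv_prod_split prod_fun_def prod.case unfolding conv_def by blast
qed

text \<open>Together with \<open>prod_fun\<close>, the next two maps place a functional of two variables on any two of
  three legs and one of a single variable on the leg that is left. All three placements commute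
  with convolution.\<close>

definition middle_fun :: "('y \<Rightarrow> bool) \<Rightarrow> ('x \<times> 'z \<Rightarrow> bool) \<Rightarrow> 'x \<times> 'y \<times> 'z \<Rightarrow> bool"
  where "middle_fun g F = (\<lambda>(a, b, c). g b \<and> F (a, c))"

definition last_fun :: "('z \<Rightarrow> bool) \<Rightarrow> ('x \<times> 'y \<Rightarrow> bool) \<Rightarrow> 'x \<times> 'y \<times> 'z \<Rightarrow> bool"
  where "last_fun g F = (\<lambda>(a, b, c). g c \<and> F (a, b))"

lemma conv_middle_fun:
  "middle_fun g F \<star>\<^bsub>prod_split sp (prod_split sp' sp'')\<^esub> middle_fun g' F' =
    middle_fun (g \<star>\<^bsub>sp'\<^esub> g') (F \<star>\<^bsub>prod_split sp sp''\<^esub> F')"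
proof (rule ext, clarify)
  fix a b c
  show "(middle_fun g F \<star>\<^bsub>prod_split sp (prod_split sp' sp'')\<^esub> middle_fun g' F') (a, b, c) =
    middle_fun (g \<star>\<^bsub>sp'\<^esub> g') (F \<star>\<^bsub>prod_split sp sp''\<^esub> F') (a, b, c)"
    unfolding conv_prod_split3 middle_fun_def prod.case
    unfolding conv_prod_split unfolding conv_def by blast
qed

lemma conv_last_fun:
  "last_fun g F \<star>\<^bsub>prod_split sp (prod_split sp' sp'')\<^esub> last_fun g' F' =
    last_fun (g \<star>\<^bsub>sp''\<^esub> g') (F \<star>\<^bsub>prod_split sp sp'\<^esub> F')"
proof (rule ext, clarify)
  fix a b c
  show "(last_fun g F \<star>\<^bsub>prod_split sp (prod_split sp' sp'')\<^esub> last_fun g' F') (a, b, c) =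
    last_fun (g \<star>\<^bsub>sp''\<^esub> g') (F \<star>\<^bsub>prod_split sp sp'\<^esub> F') (a, b, c)"
    unfolding conv_prod_split3 last_fun_def prod.case
    unfolding conv_prod_split unfolding conv_def by blast
qed

section \<open>Sweedler terms in a Hopf algebra\<close>

lemma join_preserving_bool_iff:
  "join_preserving (F :: 'a::Complete_Lattices.complete_lattice \<Rightarrow> bool) \<longleftrightarrow> (\<forall>A. F (Sup A) \<longleftrightarrow> (\<exists>a\<in>A. F a))"
  by (auto simp: join_preserving_def)

lemma join_preserving_comp:
  "join_preserving f \<Longrightarrow> join_preserving g \<Longrightarrow> join_preserving (\<lambda>x. f (g x))"
  by (simp add: join_preserving_def image_image)

lemma join_preserving_SUP:
  "(\<And>i. i \<in> I \<Longrightarrow> join_preserving (f i)) \<Longrightarrow> join_preserving (\<lambda>x. SUP i\<in>I. f i x)"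
proof -
  assume f: "\<And>i. i \<in> I \<Longrightarrow> join_preserving (f i)"
  have "(SUP i\<in>I. f i (Sup A)) = (SUP i\<in>I. SUP a\<in>A. f i a)" for A
    using f by (intro SUP_cong) (simp_all add: join_preserving_def)
  then show ?thesis
    unfolding join_preserving_def by (subst SUP_commute) simp
qed

lemma join_preserving_pure:
  "join_preserving (\<lambda>l. l \<boxtimes> m)" "join_preserving (\<lambda>m. l \<boxtimes> m)"
  using bi_join_preserving_pure unfolding bi_join_preserving_def by auto

lemma tensor_lift_bool: "tensor_lift f t \<longleftrightarrow> (\<exists>l m. (l, m) \<in> terms t \<and> f l m)"
  by (auto simp: tensor_lift_def)

lemma join_preserving_tensor_lift_comp:
  "join_preserving g \<Longrightarrow> g (tensor_lift f t) = tensor_lift (\<lambda>l m. g (f l m)) t"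
  by (simp add: tensor_lift_def join_preserving_def image_image case_prod_beta)

lemma tensor_lift_tensor_map:
  assumes "bi_join_preserving f"
  shows "tensor_lift f (tensor_map F G t) = tensor_lift (\<lambda>l m. f (F l) (G m)) t"
  unfolding tensor_map_def
  by (simp add: join_preserving_tensor_lift_comp[OF join_preserving_tensor_lift[OF assms]]
      tensor_lift_pure[OF assms])

lemma join_preserving_lift_param:
  "(\<And>l m. join_preserving (\<lambda>x. f x l m)) \<Longrightarrow> join_preserving (\<lambda>x. tensor_lift (f x) t)"
  unfolding tensor_lift_def by (rule join_preserving_SUP) (auto simp: case_prod_beta)

lemma pure_tensor_bot: "bot \<boxtimes> m = bot" "l \<boxtimes> bot = bot"
  using join_preserving_bot[OF join_preserving_pure(1)] join_preserving_bot[OF join_preserving_pure(2)]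
  by auto

lemma terms_pure: "(l', m') \<in> terms (l \<boxtimes> m) \<longleftrightarrow> l' \<le> l \<and> m' \<le> m \<or> l' = bot \<or> m' = bot"
  by (simp add: pure_tensor.rep_eq)

lemma pure_tensor_eq_bot_iff: "l \<boxtimes> m = bot \<longleftrightarrow> l = bot \<or> m = bot"
proof
  assume "l \<boxtimes> m = bot"
  then have "l \<boxtimes> m \<le> bot \<boxtimes> bot" by simp
  then show "l = bot \<or> m = bot"
    unfolding pure_tensor_le_iff terms_pure by (auto simp: bot_unique)
qed (auto simp: pure_tensor_bot)

lemma pure_tensor_inject:
  assumes "l \<boxtimes> m = l' \<boxtimes> m'" "l \<noteq> bot" "m \<noteq> bot"
  shows "l = l'" "m = m'"
proof -
  have "l' \<noteq> bot" "m' \<noteq> bot" using assms pure_tensor_eq_bot_iff by metis+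
  moreover have "l \<boxtimes> m \<le> l' \<boxtimes> m'" "l' \<boxtimes> m' \<le> l \<boxtimes> m" using assms(1) by auto
  ultimately show "l = l'" "m = m'"
    using assms unfolding pure_tensor_le_iff terms_pure by auto
qed

lemma proj_le_proj_iff: "proj a \<le> proj b \<longleftrightarrow> a \<le> sup b ker_join"
  by transfer simp

lemma proj_le_iff: "proj a \<le> q \<longleftrightarrow> a \<le> incl q"
  by transfer simp

lemma join_preserving_proj: "join_preserving (proj :: 'a::hopf_operations \<Rightarrow> _)"
  unfolding join_preserving_def
proof (intro allI antisym)
  fix A :: "'a set"
  have "proj a \<le> Sup (proj ` A)" if "a \<in> A" for a using that by (rule SUP_upper)
  then show "proj (Sup A) \<le> Sup (proj ` A)"
    unfolding proj_le_iff by (rule Sup_least)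
  have "a \<le> incl (proj (Sup A))" if "a \<in> A" for a
    using that by (simp add: incl_proj Sup_upper le_supI1)
  then show "Sup (proj ` A) \<le> proj (Sup A)"
    by (auto intro!: SUP_least simp: proj_le_iff)
qed

lemma join_preserving_act: "join_preserving (\<lambda>p. act p l)" "join_preserving (act p)"
proof -
  have "act (Sup A) l \<le> (SUP p\<in>A. act p l)" for A
    using SUP_upper[of True A "\<lambda>p. act p l"] by (cases "True \<in> A") (auto simp: act_def simp del: SUP_le_iff)
  moreover have "(SUP p\<in>A. act p l) \<le> act (Sup A) l" for A
    by (rule SUP_least) (auto simp: act_def)
  ultimately show "join_preserving (\<lambda>p. act p l)"
    unfolding join_preserving_def by (blast intro: antisym)
  show "join_preserving (act p)"
    by (cases p) (auto simp: join_preserving_def act_def)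
qed

context hopf_algebra
begin

abbreviation sw :: "'a \<Rightarrow> ('a \<times> 'a) set" where "sw \<equiv> sweedler2"

lemma ex_sw: "(\<exists>a b. (a, b) \<in> sw h \<and> f a b) \<longleftrightarrow> tensor_lift f (comult h)"
  by (simp add: tensor_lift_bool sweedler2_def)

lemma join_preserving_ex_sw:
  assumes "\<And>b. join_preserving (\<lambda>a. f a b)" "\<And>a. join_preserving (f a)"
  shows "join_preserving (\<lambda>h :: 'a. \<exists>a b. (a, b) \<in> sw h \<and> f a b)"
  unfolding ex_sw
  by (rule join_preserving_comp[OF join_preserving_tensor_lift comult_join])
    (simp add: bi_join_preserving_def assms)

text \<open>The functional \<open>T\<close> induces a join-preserving map on the triple tensor product, and both sides
  are its value at the two sides of the coassociativity law.\<close>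

lemma sw_coassoc:
  assumes T1: "\<And>b c. join_preserving (\<lambda>a. T a b c)" and T2: "\<And>a c. join_preserving (\<lambda>b. T a b c)"
    and T3: "\<And>a b. join_preserving (T a b)"
  shows "(\<exists>x c. (x, c) \<in> sw h \<and> (\<exists>a b. (a, b) \<in> sw x \<and> T a b c)) \<longleftrightarrow>
    (\<exists>a x. (a, x) \<in> sw h \<and> (\<exists>b c. (b, c) \<in> sw x \<and> T a b c))"
proof -
  have bT: "bi_join_preserving (T a)" for a
    using T2 T3 by (simp add: bi_join_preserving_def)
  define \<phi> where "\<phi> = tensor_lift (\<lambda>a. tensor_lift (T a))"
  have b\<phi>: "bi_join_preserving (\<lambda>a. tensor_lift (T a))"
    unfolding bi_join_preserving_def
    by (intro conjI allI join_preserving_lift_param join_preserving_tensor_lift bT T1)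
  have j\<phi>: "join_preserving \<phi>" unfolding \<phi>_def by (rule join_preserving_tensor_lift[OF b\<phi>])
  have \<phi>: "\<phi> (a \<boxtimes> (b \<boxtimes> c)) = T a b c" for a b c
    by (simp add: \<phi>_def tensor_lift_pure[OF b\<phi>] tensor_lift_pure[OF bT])
  have bp: "bi_join_preserving (\<lambda>a b. a \<boxtimes> (b \<boxtimes> c))" for c
    unfolding bi_join_preserving_def
    by (intro conjI allI join_preserving_comp[OF join_preserving_pure(2)] join_preserving_pure)
  have ba: "bi_join_preserving (\<lambda>t c. tensor_lift (\<lambda>a b. a \<boxtimes> (b \<boxtimes> c)) t)"
    unfolding bi_join_preserving_def
    by (intro conjI allI join_preserving_tensor_lift bp join_preserving_lift_param
        join_preserving_comp[OF join_preserving_pure(2)] join_preserving_pure)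
  have "\<phi> (tensor_assoc (tensor_map comult id (comult h))) \<longleftrightarrow>
    (\<exists>x c. (x, c) \<in> sw h \<and> (\<exists>a b. (a, b) \<in> sw x \<and> T a b c))"
    unfolding tensor_assoc_def
    by (simp add: tensor_lift_tensor_map[OF ba] join_preserving_tensor_lift_comp[OF j\<phi>] \<phi>
        ex_sw)
  moreover have "\<phi> (tensor_map id comult (comult h)) \<longleftrightarrow>
    (\<exists>a x. (a, x) \<in> sw h \<and> (\<exists>b c. (b, c) \<in> sw x \<and> T a b c))"
    unfolding \<phi>_def by (simp add: tensor_lift_tensor_map[OF b\<phi>] ex_sw)
  ultimately show ?thesis by (simp add: comult_coassoc)
qed

text \<open>Stated for the values of \<open>F\<close>, the counit law serves for elements, with \<open>F\<close> the identity, as well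
  as for functionals.\<close>

lemma sw_counit_left:
  "join_preserving F \<Longrightarrow> F a = (SUP (b, c)\<in>sw a. if counit b then F c else bot)"
  for F :: "'a \<Rightarrow> 'b::Complete_Lattices.complete_lattice"
proof -
  assume F: "join_preserving F"
  have b: "bi_join_preserving (act :: bool \<Rightarrow> 'a \<Rightarrow> 'a)"
    by (simp add: bi_join_preserving_def join_preserving_act)
  have "F a = F (tensor_lift act (tensor_map counit id (comult a)))" by (simp add: counit_left)
  then show ?thesis
    by (simp add: tensor_lift_tensor_map[OF b] join_preserving_tensor_lift_comp[OF F])
      (simp add: tensor_lift_def sweedler2_def act_def join_preserving_bot[OF F] if_distrib cong: if_cong)
qed

lemma sw_counit_right:
  "join_preserving F \<Longrightarrow> F a = (SUP (b, c)\<in>sw a. if counit c then F b else bot)"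
  for F :: "'a \<Rightarrow> 'b::Complete_Lattices.complete_lattice"
proof -
  assume F: "join_preserving F"
  have b: "bi_join_preserving (\<lambda>(b::'a) p. act p b)"
    by (simp add: bi_join_preserving_def join_preserving_act)
  have "F a = F (tensor_lift (\<lambda>b p. act p b) (tensor_map id counit (comult a)))" by (simp add: counit_right)
  then show ?thesis
    by (simp add: tensor_lift_tensor_map[OF b] join_preserving_tensor_lift_comp[OF F])
      (simp add: tensor_lift_def sweedler2_def act_def join_preserving_bot[OF F] if_distrib cong: if_cong)
qed

lemma sw_counit:
  assumes "join_preserving F"
  shows "(\<exists>b c. (b, c) \<in> sw a \<and> counit b \<and> F c) \<longleftrightarrow> F a"
    and "(\<exists>b c. (b, c) \<in> sw a \<and> F b \<and> counit c) \<longleftrightarrow> F a"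
proof -
  have 1: "(SUP (b, c)\<in>sw a. if counit b then F c else bot) \<longleftrightarrow>
      (\<exists>b c. (b, c) \<in> sw a \<and> counit b \<and> F c)"
    and 2: "(SUP (b, c)\<in>sw a. if counit c then F b else bot) \<longleftrightarrow>
      (\<exists>b c. (b, c) \<in> sw a \<and> F b \<and> counit c)"
    by (auto split: if_splits)
  show "(\<exists>b c. (b, c) \<in> sw a \<and> counit b \<and> F c) \<longleftrightarrow> F a"
    by (rule trans[OF 1[symmetric] sw_counit_left[OF assms, symmetric]])
  show "(\<exists>b c. (b, c) \<in> sw a \<and> F b \<and> counit c) \<longleftrightarrow> F a"
    by (rule trans[OF 2[symmetric] sw_counit_right[OF assms, symmetric]])
qed

lemma join_preserving_hprod:
  "join_preserving (\<lambda>a :: 'a. a \<cdot> b)" "join_preserving (\<lambda>b :: 'a. a \<cdot> b)"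
  by (intro join_preserving_comp[OF hmult_join] join_preserving_pure)+

lemma sw_hprod:
  assumes f1: "\<And>b. join_preserving (\<lambda>a. f a b)" and f2: "\<And>a. join_preserving (f a)"
  shows "(\<exists>u v. (u, v) \<in> sw (a \<cdot> b) \<and> f u v) \<longleftrightarrow>
    (\<exists>a1 a2. (a1, a2) \<in> sw a \<and> (\<exists>b1 b2. (b1, b2) \<in> sw b \<and> f (a1 \<cdot> b1) (a2 \<cdot> b2)))"
proof -
  have b: "bi_join_preserving f" by (simp add: bi_join_preserving_def f1 f2)
  show ?thesis
    unfolding ex_sw comult_hmult tensor_mult_def
    by (simp add: join_preserving_tensor_lift_comp[OF join_preserving_tensor_lift[OF b]]
      tensor_lift_pure[OF b])
qed

lemma hmult_map:
  fixes f g :: "'a \<Rightarrow> 'a"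
  shows "hmult (tensor_map f g (comult a)) = (SUP (b, c)\<in>sw a. f b \<cdot> g c)"
  by (simp add: tensor_map_def join_preserving_tensor_lift_comp[OF hmult_join])
    (simp add: tensor_lift_def sweedler2_def)

lemma sw_antipode:
  "(SUP (b, c)\<in>sw a. b \<cdot> antipode c) = act (counit a) hone"
  "(SUP (b, c)\<in>sw a. antipode b \<cdot> c) = act (counit a) hone"
  using antipode_right[of a] antipode_left[of a] unfolding hmult_map by auto

lemma counit_Sup: "counit (Sup A) \<longleftrightarrow> (\<exists>a\<in>A. counit a)" for A :: "'a set"
  using counit_join by (simp add: join_preserving_bool_iff)

lemma hprod_mono: "a \<le> a' \<Longrightarrow> b \<le> b' \<Longrightarrow> a \<cdot> b \<le> a' \<cdot> b'" for a :: 'a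
  using join_preserving_mono[OF join_preserving_hprod(1)] join_preserving_mono[OF join_preserving_hprod(2)]
  by (meson order_trans)

lemma counit_mono: "counit a \<Longrightarrow> a \<le> b \<Longrightarrow> counit b" for a :: 'a
  using join_preserving_mono[OF counit_join] by auto

lemma not_counit_ker_join: "\<not> counit (ker_join :: 'a)"
  by (simp add: ker_join_def counit_Sup)

lemma le_ker_join_iff: "a \<le> ker_join \<longleftrightarrow> \<not> counit a" for a :: 'a
  using not_counit_ker_join counit_mono by (auto simp: ker_join_def intro: Sup_upper)

lemma proj_eq_bot_iff: "proj a = bot \<longleftrightarrow> \<not> counit a" for a :: 'a
proof -
  have "proj a = bot \<longleftrightarrow> proj a \<le> proj bot"
    by (simp add: join_preserving_bot[OF join_preserving_proj] bot_unique)
  then show ?thesis by (simp add: proj_le_proj_iff le_ker_join_iff)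
qed

lemma sw_le:
  assumes "(a, b) \<in> sw h"
  shows "counit a \<Longrightarrow> b \<le> h" "counit b \<Longrightarrow> a \<le> h"
proof -
  have id: "join_preserving (\<lambda>x :: 'a. x)" by (simp add: join_preserving_def)
  have "(case (a, b) of (a, b) \<Rightarrow> if counit a then b else bot) \<le> h"
    by (rule ord_le_eq_trans[OF SUP_upper[OF assms] sw_counit_left[OF id, symmetric]])
  then show "counit a \<Longrightarrow> b \<le> h" by simp
  have "(case (a, b) of (a, b) \<Rightarrow> if counit b then a else bot) \<le> h"
    by (rule ord_le_eq_trans[OF SUP_upper[OF assms] sw_counit_right[OF id, symmetric]])
  then show "counit b \<Longrightarrow> a \<le> h" by simp
qed

lemma sw_ex_counit: "counit h \<Longrightarrow> \<exists>a b. (a, b) \<in> sw h \<and> counit a \<and> counit b"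
  by (rule iffD2[OF sw_counit(1)[OF counit_join]])

text \<open>Apply the counit to the antipode law: as the counit is multiplicative, \<open>\<epsilon>(S a)\<close> appears as
  \<open>\<epsilon>(a\<^sub>1) \<epsilon>(S a\<^sub>2) = \<epsilon>(a\<^sub>1 . S a\<^sub>2)\<close>.\<close>

lemma counit_antipode: "counit (antipode a) \<longleftrightarrow> counit a" for a :: 'a
proof -
  have "counit (antipode a) \<longleftrightarrow> (\<exists>b c. (b, c) \<in> sw a \<and> counit b \<and> counit (antipode c))"
    by (rule sw_counit(1)[where F = "\<lambda>a. counit (antipode a)", symmetric])
      (rule join_preserving_comp[OF counit_join antipode_join])
  also have "\<dots> \<longleftrightarrow> counit (SUP (b, c)\<in>sw a. b \<cdot> antipode c)"
    by (simp add: counit_Sup counit_hmult Bex_def)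
  also have "\<dots> \<longleftrightarrow> counit a"
    using counit_Sup[of "{}"] by (simp add: sw_antipode act_def counit_hone)
  finally show ?thesis .
qed

lemma hprod_sup:
  "sup a c \<cdot> b = sup (a \<cdot> b) (c \<cdot> b)" "b \<cdot> sup a c = sup (b \<cdot> a) (b \<cdot> c)" for a b c :: 'a
  using join_preserving_hprod(1)[of b, unfolded join_preserving_def, rule_format, of "{a, c}"]
    join_preserving_hprod(2)[of b, unfolded join_preserving_def, rule_format, of "{a, c}"]
  by simp_all

lemma quot_mult_proj: "quot_mult (proj a) (proj b) = proj (a \<cdot> b)" for a :: 'a
proof (rule antisym)
  have "ker_join \<cdot> b \<le> ker_join" "a \<cdot> ker_join \<le> ker_join" for a b :: 'a
    by (simp_all add: le_ker_join_iff counit_hmult not_counit_ker_join)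
  then show "quot_mult (proj a) (proj b) \<le> proj (a \<cdot> b)"
    unfolding quot_mult_def incl_proj proj_le_proj_iff hprod_sup
    by (intro sup_least sup_ge1) (auto intro: le_supI2)
  show "proj (a \<cdot> b) \<le> quot_mult (proj a) (proj b)"
    unfolding quot_mult_def incl_proj
    by (intro join_preserving_mono[OF join_preserving_proj] hprod_mono) auto
qed

end

section \<open>The remnant as the group of invertible elements\<close>

lemma join_preserving_sup: "join_preserving f \<Longrightarrow> f (sup a b) = sup (f a) (f b)"
  unfolding join_preserving_def by (drule spec[of _ "{a, b}"]) simp

lemma incl_mono: "p \<le> q \<Longrightarrow> incl p \<le> incl q"
  by transfer simp

lemma proj_mono: "a \<le> b \<Longrightarrow> proj a \<le> proj b"
  by (rule join_preserving_mono[OF join_preserving_proj])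

lemma terms_Abs_tensor: "bi_ideal D \<Longrightarrow> terms (Abs_tensor D) = D"
  by (simp add: Abs_tensor_inverse)

text \<open>This identifies joins of diagonal elements \<open>k \<boxtimes> k\<close> with \<open>k\<close> an atom: no further pure tensors
  with nonzero components lie below such a join.\<close>

lemma bi_ideal_diagonal:
  fixes K :: "'a::Complete_Lattices.complete_lattice set"
  assumes atom: "\<And>k l. k \<in> K \<Longrightarrow> l \<le> k \<Longrightarrow> l = bot \<or> l = k"
  shows "bi_ideal {(p, q). p = bot \<or> q = bot \<or> p = q \<and> p \<in> K}"
proof -
  have Sup: "Sup A = bot \<or> Sup A = q" if "\<And>l. l \<in> A \<Longrightarrow> l = bot \<or> l = q" for A and q :: 'a
  proof (cases "q \<in> A")
    case True
    have "Sup A = q"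
      by (rule antisym[OF Sup_least Sup_upper[OF True]]) (metis that bot_least order_refl)
    then show ?thesis ..
  next
    case False
    then have "Sup A = bot" using that by (auto simp: Sup_bot_conv)
    then show ?thesis ..
  qed
  show ?thesis
    unfolding bi_ideal_def mem_Collect_eq case_prod_conv
  proof (intro conjI allI impI)
    fix l m l' m' :: 'a
    assume "l = bot \<or> m = bot \<or> l = m \<and> l \<in> K" "l' \<le> l" "m' \<le> m"
    then show "l' = bot \<or> m' = bot \<or> l' = m' \<and> l' \<in> K"
      using atom[of l l'] atom[of l m'] by (auto simp: bot_unique)
  next
    fix A and m :: 'a
    assume *: "\<forall>l\<in>A. l = bot \<or> m = bot \<or> l = m \<and> l \<in> K"
    show "Sup A = bot \<or> m = bot \<or> Sup A = m \<and> Sup A \<in> K"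
    proof (cases "m = bot \<or> m \<notin> K")
      case True
      then have "m = bot \<or> Sup A = bot" using * by (auto simp: Sup_bot_conv)
      then show ?thesis by auto
    qed (use * Sup[of A m] in auto)
  next
    fix A and m :: 'a
    assume *: "\<forall>l\<in>A. m = bot \<or> l = bot \<or> m = l \<and> m \<in> K"
    show "m = bot \<or> Sup A = bot \<or> m = Sup A \<and> m \<in> K"
    proof (cases "m = bot \<or> m \<notin> K")
      case True
      then have "m = bot \<or> Sup A = bot" using * by (auto simp: Sup_bot_conv)
      then show ?thesis by auto
    qed (use * Sup[of A m] in auto)
  qed
qed

context hopf_algebra
begin

abbreviation quot_prod :: "'a remnant_quot \<Rightarrow> 'a remnant_quot \<Rightarrow> 'a remnant_quot"
    (infixl "\<odot>" 70)
  where "quot_prod \<equiv> quot_mult"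

abbreviation quot_one :: "'a remnant_quot" where "quot_one \<equiv> proj hone"

lemma quot_mult_assoc: "p \<odot> q \<odot> r = p \<odot> (q \<odot> r)"
  using proj_incl[of p] proj_incl[of q] proj_incl[of r] by (metis quot_mult_proj hmult_assoc)

lemma quot_mult_one: "quot_one \<odot> q = q" "q \<odot> quot_one = q"
  using proj_incl[of q] by (metis quot_mult_proj hmult_hone_left, metis quot_mult_proj hmult_hone_right)

lemma quot_mult_mono: "p \<le> p' \<Longrightarrow> q \<le> q' \<Longrightarrow> p \<odot> q \<le> p' \<odot> q'" for p q :: "'a remnant_quot"
  unfolding quot_mult_def by (intro proj_mono hprod_mono incl_mono)

lemma counit_incl: "counit (incl q) \<longleftrightarrow> q \<noteq> bot" for q :: "'a remnant_quot"
  using proj_eq_bot_iff[of "incl q"] by (simp add: proj_incl)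

lemma quot_mult_eq_bot_iff: "p \<odot> q = bot \<longleftrightarrow> p = bot \<or> q = bot" for p q :: "'a remnant_quot"
  by (simp add: quot_mult_def proj_eq_bot_iff counit_hmult counit_incl)

lemma quot_one_neq_bot: "quot_one \<noteq> bot"
  by (simp add: proj_eq_bot_iff counit_hone)

text \<open>The inverse of the antipode preserves the counit as well, so it also maps \<open>ker_join\<close> below
  itself. Hence the map induced by the antipode on the quotient is injective
  (\<open>proj_antipode_eq_iff\<close>).\<close>

lemma antipode_ker_join: "antipode ker_join = (ker_join :: 'a)"
proof (rule antisym)
  show "antipode ker_join \<le> (ker_join :: 'a)"
    by (simp add: le_ker_join_iff counit_antipode not_counit_ker_join)
  obtain k :: 'a where k: "ker_join = antipode k"
    using antipode_bij by (metis bij_pointE)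
  then have "k \<le> ker_join"
    by (metis le_ker_join_iff counit_antipode not_counit_ker_join)
  then show "ker_join \<le> antipode (ker_join :: 'a)"
    by (subst k) (rule join_preserving_mono[OF antipode_join])
qed

lemma antipode_le_iff: "antipode a \<le> antipode b \<longleftrightarrow> a \<le> b" for a b :: 'a
  using join_preserving_sup[OF antipode_join, of a b] antipode_bij
  by (metis bij_pointE le_iff_sup)

lemma proj_antipode_le_iff: "proj (antipode a) \<le> proj (antipode b) \<longleftrightarrow> proj a \<le> proj b" for a b :: 'a
proof -
  have "sup (antipode b) ker_join = antipode (sup b ker_join)"
    by (simp add: join_preserving_sup[OF antipode_join] antipode_ker_join)
  then show ?thesis by (simp add: proj_le_proj_iff antipode_le_iff)
qed

lemma proj_antipode_eq_iff: "proj (antipode a) = proj (antipode b) \<longleftrightarrow> proj a = proj b" for a b :: 'a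
  by (simp add: order_eq_iff proj_antipode_le_iff)

lemma antipode_hone: "antipode hone = (hone :: 'a)"
proof -
  have b: "bi_join_preserving (\<lambda>l m :: 'a. id l \<boxtimes> antipode m)"
    unfolding bi_join_preserving_def id_apply
    by (intro conjI allI join_preserving_pure join_preserving_comp[OF join_preserving_pure(2)] antipode_join)
  have "hmult (tensor_map id antipode (comult hone)) = (hone :: 'a)"
    by (simp add: antipode_right act_def counit_hone)
  then show ?thesis
    unfolding comult_hone tensor_map_def tensor_lift_pure[OF b] by (simp add: hmult_hone_left)
qed

text \<open>For a term \<open>(b, c)\<close> of the coproduct of \<open>p \<le> 1\<close>, with \<open>b, c\<close> of counit \<open>True\<close>, both \<open>b\<close> and
  \<open>c\<close> lie below \<open>p\<close>. So in the quotient \<open>b . S c \<le> p . S 1 = p\<close>, while the join of all these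
  products is \<open>1\<close>.\<close>

lemma quot_one_atom:
  assumes "p \<le> quot_one" "p \<noteq> bot"
  shows "p = quot_one"
proof (rule antisym)
  let ?p = "incl p"
  have "proj (b \<cdot> antipode c) \<le> p" if bc: "(b, c) \<in> sw ?p" for b c
  proof (cases "counit b \<and> counit c")
    case True
    then have "b \<le> ?p" "c \<le> ?p" using sw_le[OF bc] by auto
    then have "proj b \<le> p" "proj (antipode c) \<le> proj (antipode ?p)"
      unfolding proj_antipode_le_iff by (simp_all add: proj_le_iff proj_incl)
    moreover have "proj (antipode ?p) \<le> quot_one"
      using proj_antipode_le_iff[of ?p hone] assms(1) by (simp add: antipode_hone proj_incl)
    ultimately have "proj b \<odot> proj (antipode c) \<le> p \<odot> quot_one"
      by (blast intro: quot_mult_mono order_trans)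
    then show ?thesis by (simp add: quot_mult_proj quot_mult_one)
  next
    case False
    then have "proj (b \<cdot> antipode c) = bot"
      by (simp add: proj_eq_bot_iff counit_hmult counit_antipode)
    then show ?thesis by simp
  qed
  then have "(SUP (b, c)\<in>sw ?p. b \<cdot> antipode c) \<le> ?p"
    by (auto intro!: SUP_least simp: proj_le_iff)
  then show "quot_one \<le> p"
    using assms(2) by (simp add: sw_antipode act_def counit_incl proj_le_iff)
qed (rule assms(1))

text \<open>By the antipode law these products are nonzero and below the unit, which is an atom.\<close>

lemma sw_antipode_inverse:
  assumes "(a, b) \<in> sw h" "counit a" "counit b"
  shows "proj a \<odot> proj (antipode b) = quot_one" "proj (antipode a) \<odot> proj b = quot_one"
proof -
  have "(case (a, b) of (a, b) \<Rightarrow> a \<cdot> antipode b) \<le> act (counit h) hone"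
    "(case (a, b) of (a, b) \<Rightarrow> antipode a \<cdot> b) \<le> act (counit h) hone"
    using SUP_upper[OF assms(1), of "\<lambda>(b, c). b \<cdot> antipode c"]
      SUP_upper[OF assms(1), of "\<lambda>(b, c). antipode b \<cdot> c"]
    by (simp_all add: sw_antipode)
  moreover have "act (counit h) hone \<le> hone" by (simp add: act_def)
  ultimately have "proj (a \<cdot> antipode b) \<le> quot_one" "proj (antipode a \<cdot> b) \<le> quot_one"
    by (auto intro!: proj_mono elim: order_trans)
  then show "proj a \<odot> proj (antipode b) = quot_one" "proj (antipode a) \<odot> proj b = quot_one"
    using assms(2,3)
    by (auto simp: quot_mult_proj proj_eq_bot_iff counit_hmult counit_antipode intro!: quot_one_atom)
qed

text \<open>Since \<open>b\<^sub>1 \<le> b\<close>, also \<open>a . S b\<^sub>1\<close> is nonzero and below \<open>1\<close>, hence equal to it. Comparing this with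
  \<open>S b\<^sub>1 . b\<^sub>2 = 1\<close> and \<open>a . S b = 1\<close> determines \<open>b\<^sub>1\<close> and \<open>b\<^sub>2\<close>, because \<open>S\<close> is injective on the
  quotient.\<close>

lemma sw_nested:
  assumes ab: "(a, b) \<in> sw h" "counit a" "counit b"
    and b12: "(b1, b2) \<in> sw b" "counit b1" "counit b2"
  shows "proj b1 = proj b" "proj b2 = proj a"
proof -
  have le: "b1 \<le> b" using sw_le(2)[OF b12(1)] b12 by simp
  have "proj a \<odot> proj (antipode b1) \<le> proj a \<odot> proj (antipode b)"
    using le by (intro quot_mult_mono order_refl) (simp add: proj_antipode_le_iff proj_mono)
  then have 1: "proj a \<odot> proj (antipode b1) = quot_one"
    using ab b12 unfolding sw_antipode_inverse[OF ab] by (intro quot_one_atom)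
      (auto simp: quot_mult_proj proj_eq_bot_iff counit_hmult counit_antipode)
  have 2: "proj (antipode b1) \<odot> proj b2 = quot_one" by (rule sw_antipode_inverse[OF b12])
  show 3: "proj b2 = proj a"
    using arg_cong[OF 1, of "\<lambda>q. q \<odot> proj b2"] by (simp add: quot_mult_assoc 2 quot_mult_one)
  have "proj (antipode b1) = proj (antipode b)"
    using arg_cong[OF 2, of "\<lambda>q. q \<odot> proj (antipode b)"]
    by (simp add: quot_mult_assoc 3 sw_antipode_inverse[OF ab] quot_mult_one)
  then show "proj b1 = proj b" by (simp add: proj_antipode_eq_iff)
qed

text \<open>By \<open>sw_nested\<close> every term of the coproduct of \<open>b\<close> whose components are not bottom in the
  quotient has class \<open>(b, a)\<close>, and the counit law recovers \<open>b\<close> as the join of the second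
  components.\<close>

lemma sw_diagonal:
  assumes ab: "(a, b) \<in> sw h" "counit a" "counit b"
  shows "proj a = proj b"
proof (rule antisym)
  obtain b1 b2 where "(b1, b2) \<in> sw b" "counit b1" "counit b2"
    using sw_ex_counit ab(3) by blast
  then show "proj a \<le> proj b"
    using sw_nested[OF ab, of b1 b2] sw_le(1)[of b1 b2 b] by (metis proj_mono)
  have id: "join_preserving (\<lambda>x :: 'a. x)" by (simp add: join_preserving_def)
  have "b2 \<le> incl (proj a)" if "(b1, b2) \<in> sw b" "counit b1" for b1 b2
  proof (cases "counit b2")
    case True
    then show ?thesis using sw_nested(2)[OF ab that] by (simp flip: proj_le_iff)
  next
    case False
    then have "proj b2 = bot" by (simp add: proj_eq_bot_iff)
    then show ?thesis by (simp flip: proj_le_iff)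
  qed
  then have "b \<le> incl (proj a)"
    by (subst sw_counit_left[OF id]) (auto intro!: SUP_least)
  then show "proj b \<le> proj a" by (simp add: proj_le_iff)
qed

text \<open>Translating by \<open>v\<close> moves \<open>k \<le> u\<close> to an element below the unit.\<close>

lemma invertible_atom:
  assumes "u \<odot> v = quot_one" "v \<odot> u = quot_one" "k \<le> u" "k \<noteq> bot"
  shows "k = u"
proof -
  have "k \<odot> v \<le> quot_one" using assms(1) quot_mult_mono[OF assms(3) order_refl, of v] by simp
  moreover have "k \<odot> v \<noteq> bot"
    using assms quot_mult_eq_bot_iff quot_one_neq_bot by metis
  ultimately have "k \<odot> v = quot_one" by (rule quot_one_atom)
  then show ?thesis using assms(2) by (metis quot_mult_assoc quot_mult_one)
qed

text \<open>By \<open>sw_diagonal\<close> the coproduct of the class of \<open>h\<close> is the join of \<open>g \<boxtimes> g\<close> over these \<open>g\<close>. They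
  turn out to be the elements of the remnant below that class (\<open>diagonal_parts_eq\<close>).\<close>

definition diagonal_parts :: "'a \<Rightarrow> 'a remnant_quot set"
  where "diagonal_parts h = {proj b | a b. (a, b) \<in> sw h \<and> counit a \<and> counit b}"

lemma diagonal_parts_invertible:
  assumes "g \<in> diagonal_parts h"
  shows "\<exists>v. g \<odot> v = quot_one \<and> v \<odot> g = quot_one"
proof -
  obtain a b where ab: "g = proj b" "(a, b) \<in> sw h" "counit a" "counit b"
    using assms by (auto simp: diagonal_parts_def)
  have "proj a = proj b" by (rule sw_diagonal[OF ab(2-4)])
  moreover then have "proj (antipode a) = proj (antipode b)" by (simp add: proj_antipode_eq_iff)
  ultimately show ?thesis
    using sw_antipode_inverse[OF ab(2-4)] ab(1) by metis
qed

lemma diagonal_parts_atom: "g \<in> diagonal_parts h \<Longrightarrow> l \<le> g \<Longrightarrow> l = bot \<or> l = g"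
  using diagonal_parts_invertible invertible_atom by metis

lemma diagonal_parts_le: "g \<in> diagonal_parts h \<Longrightarrow> g \<le> proj h"
  unfolding diagonal_parts_def using sw_le(1) proj_mono by blast

lemma diagonal_parts_neq_bot: "g \<in> diagonal_parts h \<Longrightarrow> g \<noteq> bot"
  by (auto simp: diagonal_parts_def proj_eq_bot_iff)

lemma diagonal_parts_part: "g \<in> diagonal_parts h \<Longrightarrow> \<exists>b. g = proj b \<and> diagonal_parts b = {g}"
proof -
  assume "g \<in> diagonal_parts h"
  then obtain a b where ab: "g = proj b" "(a, b) \<in> sw h" "counit a" "counit b"
    by (auto simp: diagonal_parts_def)
  have "proj b2 = g" if "(b1, b2) \<in> sw b" "counit b1" "counit b2" for b1 b2
    using sw_nested[OF ab(2-4) that] sw_diagonal[OF ab(2-4)] ab(1) by simp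
  then have "diagonal_parts b = {g}"
    using sw_ex_counit[OF ab(4)] unfolding diagonal_parts_def by blast
  with ab(1) show ?thesis by blast
qed

abbreviation proj_comult :: "'a \<Rightarrow> ('a remnant_quot, 'a remnant_quot) tensor"
  where "proj_comult h \<equiv> tensor_map proj proj (comult h)"

lemma bi_join_preserving_proj_pure: "bi_join_preserving (\<lambda>(l :: 'a) (m :: 'a). proj l \<boxtimes> proj m)"
  unfolding bi_join_preserving_def
  by (intro conjI allI join_preserving_proj join_preserving_comp[OF join_preserving_pure(1)]
      join_preserving_comp[OF join_preserving_pure(2)])

lemma join_preserving_tensor_map_proj: "join_preserving (tensor_map (proj :: 'a \<Rightarrow> _) (proj :: 'a \<Rightarrow> _))"
  unfolding tensor_map_def by (rule join_preserving_tensor_lift[OF bi_join_preserving_proj_pure])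

lemma join_preserving_proj_comult: "join_preserving proj_comult"
  by (rule join_preserving_comp[OF join_preserving_tensor_map_proj comult_join])

lemma proj_comult_terms:
  assumes "(p, q) \<in> terms (proj_comult h)" "p \<noteq> bot" "q \<noteq> bot"
  shows "p = q \<and> p \<in> diagonal_parts h"
proof -
  let ?D = "{(p, q). p = bot \<or> q = bot \<or> p = q \<and> p \<in> diagonal_parts h}"
  have D: "bi_ideal ?D" by (rule bi_ideal_diagonal) (rule diagonal_parts_atom)
  have "proj l \<boxtimes> proj m \<le> Abs_tensor ?D" if "(l, m) \<in> terms (comult h)" for l m
    unfolding pure_tensor_le_iff terms_Abs_tensor[OF D]
    using sw_diagonal[of l m h] that by (auto simp: diagonal_parts_def sweedler2_def proj_eq_bot_iff)
  then have "proj_comult h \<le> Abs_tensor ?D"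
    unfolding tensor_map_def tensor_lift_def by (intro SUP_least) (simp only: case_prod_beta prod.collapse)
  then have "terms (proj_comult h) \<subseteq> ?D"
    by (simp add: less_eq_tensor.rep_eq terms_Abs_tensor[OF D])
  with assms show ?thesis by auto
qed

lemma diagonal_parts_proj_comult: "g \<in> diagonal_parts h \<Longrightarrow> g \<boxtimes> g \<le> proj_comult h"
proof -
  assume "g \<in> diagonal_parts h"
  then obtain a b where ab: "g = proj b" "(a, b) \<in> sw h" "counit a" "counit b"
    by (auto simp: diagonal_parts_def)
  have "proj a \<boxtimes> proj b \<le> proj_comult h"
    unfolding tensor_map_def tensor_lift_def
    by (rule SUP_upper2[of "(a, b)"]) (use ab in \<open>auto simp: sweedler2_def\<close>)
  then show ?thesis using sw_diagonal[OF ab(2-4)] ab(1) by simp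
qed

text \<open>The representative \<open>incl (proj h)\<close> exceeds \<open>h\<close> by \<open>ker_join\<close>, whose coproduct has no term with
  both components of counit \<open>True\<close>.\<close>

lemma quot_comult_proj: "quot_comult (proj h) = proj_comult h" for h :: 'a
proof -
  have "diagonal_parts ker_join = {}"
    using diagonal_parts_le diagonal_parts_neq_bot proj_eq_bot_iff not_counit_ker_join bot_unique by (metis equals0I)
  then have "proj_comult ker_join \<le> proj_comult h"
    unfolding less_eq_tensor.rep_eq
    using proj_comult_terms[of _ _ ker_join] pure_tensor_le_iff[of bot _ "proj_comult h"] pure_tensor_le_iff[of _ bot "proj_comult h"]
    by (auto simp: pure_tensor_bot) metis
  then show ?thesis
    unfolding quot_comult_def incl_proj
    by (simp add: join_preserving_sup[OF join_preserving_proj_comult] sup_absorb1)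
qed

lemma diagonal_parts_in_remnant:
  assumes "g \<in> diagonal_parts h"
  shows "g \<in> remnant"
proof -
  obtain b where b: "g = proj b" "diagonal_parts b = {g}" using diagonal_parts_part[OF assms] by blast
  have "proj_comult b \<le> g \<boxtimes> g"
    unfolding less_eq_tensor.rep_eq using proj_comult_terms[of _ _ b] b(2)
    by (clarsimp simp: terms_pure) (metis order_refl singletonD)
  moreover have "g \<boxtimes> g \<le> proj_comult b" using diagonal_parts_proj_comult b(2) by blast
  ultimately have "quot_comult g = g \<boxtimes> g"
    using b(1) quot_comult_proj by (metis antisym)
  then show ?thesis using diagonal_parts_neq_bot[OF assms] by (simp add: remnant_def)
qed

lemma remnant_in_diagonal_parts:
  assumes "g \<in> remnant" "g \<le> proj h"
  shows "g \<in> diagonal_parts h"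
proof -
  have "quot_comult g \<le> quot_comult (proj h)"
    unfolding quot_comult_def
    by (intro join_preserving_mono[OF join_preserving_proj_comult] incl_mono assms)
  then have "(g, g) \<in> terms (proj_comult h)"
    using assms by (simp add: quot_comult_proj remnant_def flip: pure_tensor_le_iff)
  then show ?thesis using proj_comult_terms assms(1) by (auto simp: remnant_def)
qed

lemma diagonal_parts_eq: "diagonal_parts h = {g \<in> remnant. g \<le> proj h}"
  using diagonal_parts_in_remnant remnant_in_diagonal_parts diagonal_parts_le by blast

lemma remnant_invertible: "g \<in> remnant \<Longrightarrow> \<exists>v. g \<odot> v = quot_one \<and> v \<odot> g = quot_one"
  using remnant_in_diagonal_parts[of g "incl g"] diagonal_parts_invertible by (simp add: proj_incl)

text \<open>The counit law writes \<open>h\<close> as the join of the second components of the terms of its coproduct,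
  whose classes are bottom or lie in the remnant.\<close>

lemma proj_eq_Sup_remnant: "proj h = Sup {g \<in> remnant. g \<le> proj h}" for h :: 'a
proof (rule antisym)
  let ?q = "Sup {g \<in> remnant. g \<le> proj h}"
  have id: "join_preserving (\<lambda>x :: 'a. x)" by (simp add: join_preserving_def)
  have "c \<le> incl ?q" if "(b, c) \<in> sw h" "counit b" for b c
  proof (cases "counit c")
    case True
    with that have "proj c \<in> diagonal_parts h" by (auto simp: diagonal_parts_def)
    then have "proj c \<le> ?q" unfolding diagonal_parts_eq by (rule Sup_upper)
    then show ?thesis by (simp add: proj_le_iff)
  next
    case False
    then have "proj c = bot" by (simp add: proj_eq_bot_iff)
    then show ?thesis by (simp flip: proj_le_iff)
  qed
  then have "h \<le> incl ?q"
    by (subst sw_counit_left[OF id]) (auto intro!: SUP_least)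
  then show "proj h \<le> ?q" by (simp add: proj_le_iff)
qed (auto intro: Sup_least)

lemma quot_eq_Sup_remnant: "q = Sup {g \<in> remnant. g \<le> q}" for q :: "'a remnant_quot"
  using proj_eq_Sup_remnant[of "incl q"] by (simp add: proj_incl)

lemma ex_remnant_le: "q \<noteq> bot \<Longrightarrow> \<exists>g\<in>remnant. g \<le> q" for q :: "'a remnant_quot"
  using quot_eq_Sup_remnant[of q] by (metis (mono_tags, lifting) Sup_empty empty_Collect_eq)

text \<open>An invertible element is an atom, and as a join of remnant elements it must be one of them.\<close>

lemma remnant_iff_invertible: "g \<in> remnant \<longleftrightarrow> (\<exists>v. g \<odot> v = quot_one \<and> v \<odot> g = quot_one)"
  (is "_ \<longleftrightarrow> ?inv")
proof
  assume ?inv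
  then obtain v where v: "g \<odot> v = quot_one" "v \<odot> g = quot_one" by blast
  then have "g \<noteq> bot" using quot_mult_eq_bot_iff quot_one_neq_bot by metis
  then obtain k where "k \<in> remnant" "k \<le> g" using ex_remnant_le by blast
  then show "g \<in> remnant" using invertible_atom[OF v] by (auto simp: remnant_def)
qed (rule remnant_invertible)

lemma remnant_atom: "g \<in> remnant \<Longrightarrow> k \<in> remnant \<Longrightarrow> k \<le> g \<Longrightarrow> k = g" for g k :: "'a remnant_quot"
  using remnant_iff_invertible invertible_atom by (auto simp: remnant_def)

definition remnant_group :: "'a remnant_quot monoid"
  where "remnant_group = \<lparr>carrier = remnant, monoid.mult = quot_mult, one = quot_one\<rparr>"

lemma remnant_group_simps:
  "carrier remnant_group = remnant" "x \<otimes>\<^bsub>remnant_group\<^esub> y = x \<odot> y" "\<one>\<^bsub>remnant_group\<^esub> = quot_one"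
  by (simp_all add: remnant_group_def)

lemma remnant_mult: "g \<in> remnant \<Longrightarrow> k \<in> remnant \<Longrightarrow> g \<odot> k \<in> remnant"
  unfolding remnant_iff_invertible by (metis quot_mult_assoc quot_mult_one(1))

lemma group_remnant_group: "group remnant_group"
proof (rule groupI)
  show "\<And>x. x \<in> carrier remnant_group \<Longrightarrow> \<exists>y\<in>carrier remnant_group. y \<otimes>\<^bsub>remnant_group\<^esub> x = \<one>\<^bsub>remnant_group\<^esub>"
    unfolding remnant_group_simps by (metis remnant_iff_invertible)
qed (auto simp: remnant_group_simps remnant_mult quot_mult_assoc quot_mult_one remnant_iff_invertible[of quot_one] intro: exI[of _ quot_one])

text \<open>Under the isomorphism of the quotient with the group algebra of the remnant, \<open>\<chi> g\<close> tells
  whether the class of its argument, as a set, contains \<open>g\<close>.\<close>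

definition \<chi> :: "'a remnant_quot \<Rightarrow> 'a \<Rightarrow> bool"
  where "\<chi> g h \<longleftrightarrow> g \<le> proj h"

text \<open>The element \<open>g \<boxtimes> g\<close> lies below the coproduct of \<open>Sup A\<close>, which is a join of diagonal elements
  coming from the members of \<open>A\<close>; by \<open>bi_ideal_diagonal\<close> it is one of them.\<close>

lemma join_preserving_chi:
  assumes "g \<in> remnant"
  shows "join_preserving (\<chi> g)"
  unfolding join_preserving_bool_iff \<chi>_def
proof (intro allI iffI)
  fix A assume "g \<le> proj (Sup A)"
  then have g: "g \<in> diagonal_parts (Sup A)" "g \<noteq> bot" using assms by (auto simp: diagonal_parts_eq remnant_def)
  let ?D = "{(p, q). p = bot \<or> q = bot \<or> p = q \<and> p \<in> (\<Union>a\<in>A. diagonal_parts a)}"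
  have D: "bi_ideal ?D" by (rule bi_ideal_diagonal) (auto dest: diagonal_parts_atom)
  have "proj_comult (Sup A) = Sup (proj_comult ` A)" using join_preserving_proj_comult unfolding join_preserving_def by blast
  also have "\<dots> \<le> Abs_tensor ?D"
    by (rule SUP_least, unfold less_eq_tensor.rep_eq terms_Abs_tensor[OF D])
      (use proj_comult_terms in blast)
  finally have "(g, g) \<in> ?D"
    using diagonal_parts_proj_comult[OF g(1)] pure_tensor_le_iff[of g g "Abs_tensor ?D"]
    unfolding terms_Abs_tensor[OF D] by (meson order_trans)
  then show "\<exists>a\<in>A. g \<le> proj a" using g(2) diagonal_parts_le by auto
next
  fix A assume "\<exists>a\<in>A. g \<le> proj a"
  then show "g \<le> proj (Sup A)" by (meson Sup_upper order_trans proj_mono)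
qed

lemma counit_iff_chi: "counit h \<longleftrightarrow> (\<exists>g\<in>remnant. \<chi> g h)"
  using ex_remnant_le[of "proj h"] proj_eq_bot_iff[of h]
  by (auto simp: \<chi>_def remnant_def bot_unique)

lemma chi_incl: "g \<in> remnant \<Longrightarrow> k \<in> remnant \<Longrightarrow> \<chi> g (incl k) \<longleftrightarrow> g = k"
  using remnant_atom by (auto simp: \<chi>_def proj_incl)

lemma chi_sw:
  assumes "g \<in> remnant" "k \<in> remnant"
  shows "(\<exists>b c. (b, c) \<in> sw h \<and> \<chi> g b \<and> \<chi> k c) \<longleftrightarrow> g = k \<and> \<chi> g h"
proof
  assume "\<exists>b c. (b, c) \<in> sw h \<and> \<chi> g b \<and> \<chi> k c"
  then obtain b c where bc: "(b, c) \<in> sw h" "\<chi> g b" "\<chi> k c" by blast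
  then have co: "counit b" "counit c" using assms counit_iff_chi by blast+
  then have "proj b = proj c" "proj b \<in> remnant"
    using sw_diagonal[OF bc(1)] bc(1) diagonal_parts_in_remnant[of "proj c" h] by (auto simp: diagonal_parts_def)
  then have "g = proj b" "k = proj b"
    using bc assms remnant_atom unfolding \<chi>_def by metis+
  then show "g = k \<and> \<chi> g h"
    using sw_le(2)[OF bc(1) co(2)] by (simp add: \<chi>_def proj_mono)
next
  assume g: "g = k \<and> \<chi> g h"
  then have "g \<in> diagonal_parts h" using assms by (auto simp: diagonal_parts_eq \<chi>_def)
  then obtain a b where ab: "g = proj b" "(a, b) \<in> sw h" "counit a" "counit b"
    by (auto simp: diagonal_parts_def)
  then show "\<exists>b c. (b, c) \<in> sw h \<and> \<chi> g b \<and> \<chi> k c"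
    using sw_diagonal[OF ab(2-4)] g by (intro exI[of _ a] exI[of _ b]) (simp add: \<chi>_def)
qed

text \<open>A functional below the counit is \<open>False\<close> on \<open>ker_join\<close> and so factors through the quotient, where
  every element is a join of remnant elements.\<close>

lemma below_counit:
  assumes F: "join_preserving F" and le: "\<And>b. F b \<Longrightarrow> counit b"
  shows "F a \<longleftrightarrow> (\<exists>g\<in>remnant. \<chi> g a \<and> F (incl g))"
proof -
  have kj: "\<not> F ker_join" using le not_counit_ker_join by blast
  have FS: "F (incl (proj b)) \<longleftrightarrow> F b" for b
    unfolding incl_proj by (simp add: join_preserving_sup[OF F] kj)
  have "proj (Sup (incl ` B)) = Sup B" for B :: "'a remnant_quot set"
    using join_preserving_proj[where 'a = 'a]
    by (simp add: join_preserving_def image_image proj_incl)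
  then have "proj a = proj (Sup (incl ` {g \<in> remnant. g \<le> proj a}))"
    using proj_eq_Sup_remnant[of a] by simp
  then have "F a \<longleftrightarrow> F (Sup (incl ` {g \<in> remnant. g \<le> proj a}))"
    using FS by metis
  also have "\<dots> \<longleftrightarrow> (\<exists>g\<in>remnant. \<chi> g a \<and> F (incl g))"
    using F unfolding join_preserving_bool_iff \<chi>_def by auto
  finally show ?thesis .
qed

sublocale H: functional_coalgebra sw counit "Collect join_preserving" remnant \<chi> incl
proof (unfold_locales, goal_cases)
  case (1 \<F>)
  then show ?case by (simp add: join_preserving_bool_iff subset_iff) blast
next
  case 2 show ?case by (simp add: counit_join)
next
  case (3 f) then show ?case by (simp add: join_preserving_ex_sw)
next
  case (4 T h) then show ?case by (intro sw_coassoc) auto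
next
  case (5 F a) then show ?case by (intro sw_counit) auto
next
  case (6 F a) then show ?case by (intro sw_counit) auto
next
  case (7 p) then show ?case by (simp add: join_preserving_chi)
next
  case (8 p q a) then show ?case by (rule chi_sw)
next
  case (9 p q) then show ?case by (rule chi_incl)
next
  case (10 a) show ?case by (rule counit_iff_chi)
next
  case (11 F a) then show ?case by (intro below_counit) auto
qed

lemma chi_hprod:
  assumes "g \<in> remnant"
  shows "\<chi> g (a \<cdot> b) \<longleftrightarrow> (\<exists>x\<in>remnant. \<exists>y\<in>remnant. x \<odot> y = g \<and> \<chi> x a \<and> \<chi> y b)"
proof -
  have J: "join_preserving (\<lambda>a. \<chi> g (a \<cdot> b))" "join_preserving (\<lambda>b. \<chi> g (a \<cdot> b))" for a b
    by (intro join_preserving_comp[OF join_preserving_chi[OF assms]] join_preserving_hprod)+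
  have c: "counit a \<and> counit b" if "\<chi> g (a \<cdot> b)" for a b
    using that assms counit_iff_chi counit_hmult by blast
  have "\<chi> g (a \<cdot> b) \<longleftrightarrow> (\<exists>x\<in>remnant. \<chi> x a \<and> \<chi> g (incl x \<cdot> b))"
    by (rule below_counit[OF J(1)]) (use c in blast)
  also have "\<dots> \<longleftrightarrow> (\<exists>x\<in>remnant. \<chi> x a \<and> (\<exists>y\<in>remnant. \<chi> y b \<and> \<chi> g (incl x \<cdot> incl y)))"
    by (subst below_counit[OF J(2)]) (use c in auto)
  also have "\<chi> g (incl x \<cdot> incl y) \<longleftrightarrow> x \<odot> y = g" if "x \<in> remnant" "y \<in> remnant" for x y
    using remnant_atom[OF remnant_mult[OF that] assms] by (auto simp: \<chi>_def quot_mult_def)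
  then have "(\<exists>x\<in>remnant. \<chi> x a \<and> (\<exists>y\<in>remnant. \<chi> y b \<and> \<chi> g (incl x \<cdot> incl y))) \<longleftrightarrow>
    (\<exists>x\<in>remnant. \<exists>y\<in>remnant. x \<odot> y = g \<and> \<chi> x a \<and> \<chi> y b)"
    by blast
  finally show ?thesis .
qed

lemma chi_hone: "g \<in> remnant \<Longrightarrow> \<chi> g hone \<longleftrightarrow> g = quot_one"
  using quot_one_atom by (auto simp: \<chi>_def remnant_def)

text \<open>On an element \<open>k\<close> of the remnant the antipode is inversion, by \<open>sw_antipode_inverse\<close> for the term
  of class \<open>(k, k)\<close> in its coproduct. The general case follows as the left side is a functional
  below the counit.\<close>

lemma chi_antipode:
  assumes "g \<in> remnant"
  shows "\<chi> g (antipode h) \<longleftrightarrow> \<chi> (inv\<^bsub>remnant_group\<^esub> g) h"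
proof -
  interpret group remnant_group by (rule group_remnant_group)
  have J: "join_preserving (\<lambda>a. \<chi> g (antipode a))"
    by (intro join_preserving_comp[OF join_preserving_chi[OF assms]] antipode_join)
  have "\<chi> g (antipode h) \<longleftrightarrow> (\<exists>k\<in>remnant. \<chi> k h \<and> \<chi> g (antipode (incl k)))"
    by (rule below_counit[OF J]) (use assms counit_iff_chi counit_antipode in blast)
  also have "\<chi> g (antipode (incl k)) \<longleftrightarrow> k = inv\<^bsub>remnant_group\<^esub> g" if k: "k \<in> remnant" for k
  proof -
    have "k \<in> diagonal_parts (incl k)" using k by (simp add: diagonal_parts_eq proj_incl)
    then obtain a b where ab: "k = proj b" "(a, b) \<in> sw (incl k)" "counit a" "counit b"
      by (auto simp: diagonal_parts_def)
    have ka: "k = proj a" using sw_diagonal[OF ab(2-4)] ab(1) by simp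
    have Sk: "proj (antipode (incl k)) = proj (antipode a)" "proj (antipode (incl k)) = proj (antipode b)"
      unfolding proj_antipode_eq_iff using ab(1) ka by (simp_all add: proj_incl)
    let ?k = "proj (antipode (incl k))"
    have 1: "k \<odot> ?k = quot_one" "?k \<odot> k = quot_one"
      using sw_antipode_inverse[OF ab(2-4)] ka ab(1) Sk by metis+
    then have "?k \<in> remnant" using remnant_iff_invertible by blast
    then have "?k = inv\<^bsub>remnant_group\<^esub> k"
      using 1 k inv_equality[of ?k k] by (simp add: remnant_group_simps)
    then have "\<chi> g (antipode (incl k)) \<longleftrightarrow> g = inv\<^bsub>remnant_group\<^esub> k"
      using remnant_atom[of ?k g] \<open>?k \<in> remnant\<close> assms by (auto simp: \<chi>_def)
    then show ?thesis
      using inv_inv[of g] inv_inv[of k] k assms by (auto simp: remnant_group_simps)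
  qed
  then have "(\<exists>k\<in>remnant. \<chi> k h \<and> \<chi> g (antipode (incl k))) \<longleftrightarrow> \<chi> (inv\<^bsub>remnant_group\<^esub> g) h"
    using inv_closed[of g] assms by (auto simp: remnant_group_simps)
  finally show ?thesis .
qed

end

section \<open>The second group structure of a braided group\<close>

lemma (in group) inv_into_action:
  assumes s: "\<And>x y. x \<in> carrier G \<Longrightarrow> y \<in> carrier G \<Longrightarrow> s x y \<in> carrier G"
    and action: "\<And>x y z. x \<in> carrier G \<Longrightarrow> y \<in> carrier G \<Longrightarrow> z \<in> carrier G \<Longrightarrow> s (x \<otimes> y) z = s x (s y z)"
    and one: "\<And>y. y \<in> carrier G \<Longrightarrow> s \<one> y = y"
    and xy: "x \<in> carrier G" "y \<in> carrier G"
  shows "inv_into (carrier G) (s x) y = s (inv x) y"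
proof (rule inv_into_f_eq)
  show "inj_on (s x) (carrier G)"
    by (rule inj_on_inverseI[of _ "s (inv x)"]) (simp add: xy one l_inv flip: action)
  show "s x (s (inv x) y) = y" by (simp add: xy one r_inv flip: action)
qed (simp add: s xy)

text \<open>The group axioms of the second structure of a skew brace. For associativity write
  \<open>y' = s (inv x) y\<close>, so that \<open>x \<star> y = x y'\<close>. Since \<open>s x y' = y\<close>, commutativity up to the
  braiding gives \<open>g x y' = inv y (x y')\<close>, and the hexagon identity moves \<open>s x\<close> across a
  product that starts with \<open>y'\<close>.\<close>

lemma (in group) braided_star_group:
  assumes s: "\<And>x y. x \<in> carrier G \<Longrightarrow> y \<in> carrier G \<Longrightarrow> s x y \<in> carrier G"
    and g: "\<And>x y. x \<in> carrier G \<Longrightarrow> y \<in> carrier G \<Longrightarrow> g x y \<in> carrier G"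
    and action: "\<And>x y z. x \<in> carrier G \<Longrightarrow> y \<in> carrier G \<Longrightarrow> z \<in> carrier G \<Longrightarrow> s (x \<otimes> y) z = s x (s y z)"
    and one: "\<And>y. y \<in> carrier G \<Longrightarrow> s \<one> y = y" "\<And>x. x \<in> carrier G \<Longrightarrow> s x \<one> = \<one>"
    and commute: "\<And>x y. x \<in> carrier G \<Longrightarrow> y \<in> carrier G \<Longrightarrow> s x y \<otimes> g x y = x \<otimes> y"
    and hexagon: "\<And>x y z. x \<in> carrier G \<Longrightarrow> y \<in> carrier G \<Longrightarrow> z \<in> carrier G \<Longrightarrow>
      s x (y \<otimes> z) = s x y \<otimes> s (g x y) z"
  shows "group \<lparr>carrier = carrier G, monoid.mult = (\<lambda>x y. x \<otimes> s (inv x) y), one = \<one>\<rparr>"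
proof -
  have assoc: "x \<otimes> s (inv x) y \<otimes> s (inv (x \<otimes> s (inv x) y)) z = x \<otimes> s (inv x) (y \<otimes> s (inv y) z)"
    if xyz: "x \<in> carrier G" "y \<in> carrier G" "z \<in> carrier G" for x y z
  proof -
    define y' where "y' = s (inv x) y"
    define w where "w = s (inv y') (s (inv x) z)"
    have y': "y' \<in> carrier G" "s x y' = y"
      by (simp_all add: y'_def s xyz one r_inv flip: action)
    have w: "w \<in> carrier G" "s x (s y' w) = z"
      by (simp_all add: w_def s xyz y' one r_inv flip: action)
        (simp_all add: action s xyz y' one r_inv flip: m_assoc)
    have "g x y' = inv y \<otimes> (x \<otimes> y')"
      using commute[OF xyz(1) y'(1)] y' xyz g[OF xyz(1) y'(1)] by (simp add: inv_solve_left)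
    then have "s (g x y') w = s (inv y) z"
      using w xyz y' by (simp add: action s)
    then have "s x (y' \<otimes> w) = y \<otimes> s (inv y) z"
      using hexagon[OF xyz(1) y'(1) w(1)] y' by simp
    then have "s (inv x) (y \<otimes> s (inv y) z) = s (inv x) (s x (y' \<otimes> w))" by simp
    also have "\<dots> = y' \<otimes> w"
      by (simp add: xyz y' w one l_inv flip: action)
    finally show ?thesis
      using xyz y' w(1) by (simp add: y'_def[symmetric] inv_mult_group action w_def s m_assoc)
  qed
  have inverse: "\<exists>y\<in>carrier G. x \<otimes> s (inv x) y = \<one>" if x: "x \<in> carrier G" for x
    by (rule bexI[of _ "s x (inv x)"]) (simp_all add: x s one l_inv r_inv flip: action)
  let ?S = "\<lparr>carrier = carrier G, monoid.mult = (\<lambda>x y. x \<otimes> s (inv x) y), one = \<one>\<rparr>"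
  have "monoid ?S"
    by (rule monoidI) (auto simp: assoc s one)
  then interpret S: monoid ?S .
  show ?thesis
  proof (rule S.group_l_invI)
    fix x assume x: "x \<in> carrier ?S"
    then obtain y where y: "y \<in> carrier ?S" "x \<otimes>\<^bsub>?S\<^esub> y = \<one>\<^bsub>?S\<^esub>" using inverse by auto
    then obtain z where z: "z \<in> carrier ?S" "y \<otimes>\<^bsub>?S\<^esub> z = \<one>\<^bsub>?S\<^esub>" using inverse by auto
    have "x = z" using S.inv_unique[of x y z] x y z by blast
    with y z show "\<exists>y\<in>carrier ?S. y \<otimes>\<^bsub>?S\<^esub> x = \<one>\<^bsub>?S\<^esub>" by blast
  qed
qed

section \<open>Conjugation by the co-quasitriangular structure\<close>

locale cqt_hopf_algebra = hopf_algebra type_of_H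
  for type_of_H :: "'a::hopf_operations itself" +
  fixes R Rinv :: "('a, 'a) tensor \<Rightarrow> bool"
  assumes cqt: "coquasitriangular R Rinv"
begin

abbreviation "JP \<equiv> Collect join_preserving :: ('a \<Rightarrow> bool) set"
abbreviation "sw2 \<equiv> prod_split sw sw"
abbreviation "sw3 \<equiv> prod_split sw sw2"
abbreviation "JP2 \<equiv> prod_functionals JP JP"
abbreviation "JP3 \<equiv> prod_functionals JP JP2"
abbreviation "chi2 \<equiv> \<lambda>(p, q). prod_fun (\<chi> p) (\<chi> q)"

sublocale H2: functional_coalgebra sw2 "prod_fun counit counit" JP2 "remnant \<times> remnant" chi2
  "map_prod incl incl"
  by (rule functional_coalgebra_prod) (rule H.functional_coalgebra_axioms)+

sublocale H3: functional_coalgebra sw3 "prod_fun counit (prod_fun counit counit)" JP3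
  "remnant \<times> remnant \<times> remnant" "\<lambda>(p, q). prod_fun (\<chi> p) (chi2 q)"
  "map_prod incl (map_prod incl incl)"
  by (rule functional_coalgebra_prod) (rule H.functional_coalgebra_axioms H2.functional_coalgebra_axioms)+

definition Rfun :: "'a \<times> 'a \<Rightarrow> bool" where "Rfun = (\<lambda>(a, b). R (a \<boxtimes> b))"
definition Rinvfun :: "'a \<times> 'a \<Rightarrow> bool" where "Rinvfun = (\<lambda>(a, b). Rinv (a \<boxtimes> b))"

lemma R_join_preserving: "join_preserving R" "join_preserving Rinv"
  using cqt unfolding coquasitriangular_def by blast+

lemma functionals2_iff: "F \<in> JP2 \<longleftrightarrow> (\<forall>b. join_preserving (\<lambda>a. F (a, b))) \<and> (\<forall>a. join_preserving (\<lambda>b. F (a, b)))"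
  by (simp add: prod_functionals_def)

lemma functionals3_iff: "F \<in> JP3 \<longleftrightarrow> (\<forall>b c. join_preserving (\<lambda>a. F (a, b, c))) \<and>
    (\<forall>a c. join_preserving (\<lambda>b. F (a, b, c))) \<and> (\<forall>a b. join_preserving (\<lambda>c. F (a, b, c)))"
  by (auto simp: prod_functionals_def)

lemma join_preserving_and: "join_preserving F \<Longrightarrow> join_preserving (\<lambda>x :: 'a. P \<and> F x)"
  "join_preserving F \<Longrightarrow> join_preserving (\<lambda>x :: 'a. F x \<and> P)"
  using H.J_and[of F P] by auto

lemma Rfun_functional: "Rfun \<in> JP2" "Rinvfun \<in> JP2"
  unfolding functionals2_iff Rfun_def Rinvfun_def prod.case
  by (intro conjI allI join_preserving_comp[OF R_join_preserving(1)] join_preserving_comp[OF R_join_preserving(2)] join_preserving_pure)+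

lemma Rfun_inverse: "Rfun \<star>\<^bsub>sw2\<^esub> Rinvfun = prod_fun counit counit" "Rinvfun \<star>\<^bsub>sw2\<^esub> Rfun = prod_fun counit counit"
proof -
  have "convolution R Rinv a b = (Rfun \<star>\<^bsub>sw2\<^esub> Rinvfun) (a, b)" "convolution Rinv R a b = (Rinvfun \<star>\<^bsub>sw2\<^esub> Rfun) (a, b)" for a b
    unfolding convolution_def conv_prod_split Rfun_def Rinvfun_def by (simp_all add: Bex_def)
  moreover have "convolution R Rinv a b = (counit a \<and> counit b)" "convolution Rinv R a b = (counit a \<and> counit b)" for a b
    using cqt unfolding coquasitriangular_def by blast+
  ultimately show "Rfun \<star>\<^bsub>sw2\<^esub> Rinvfun = prod_fun counit counit" "Rinvfun \<star>\<^bsub>sw2\<^esub> Rfun = prod_fun counit counit"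
    by (auto simp: prod_fun_apply)
qed

lemma Rfun_mult_left: "Rfun (a \<cdot> b, c) \<longleftrightarrow> (\<exists>c1 c2. (c1, c2) \<in> sw c \<and> Rfun (b, c1) \<and> Rfun (a, c2))"
  using cqt unfolding coquasitriangular_def Rfun_def by (simp add: Bex_def)

lemma Rfun_mult_right: "Rfun (a, b \<cdot> c) \<longleftrightarrow> (\<exists>a1 a2. (a1, a2) \<in> sw a \<and> Rfun (a1, b) \<and> Rfun (a2, c))"
  using cqt unfolding coquasitriangular_def Rfun_def by (simp add: Bex_def)

sublocale braid: conv_invertible sw2 "prod_fun counit counit" JP2 "remnant \<times> remnant" chi2
  "map_prod incl incl" Rfun Rinvfun
  by unfold_locales (rule Rfun_functional Rfun_inverse)+

text \<open>Conjugating \<open>\<chi> v \<otimes> \<chi> u\<close> by \<open>R\<close> tests the coproduct components in the order in which they stand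
  before \<open>\<Gamma>\<close> exchanges them. So the first component of \<open>transport\<close> is the second one of the
  braiding operator.\<close>

definition \<gamma> :: "'a remnant_quot \<Rightarrow> 'a remnant_quot \<Rightarrow> 'a remnant_quot"
  where "\<gamma> x y = fst (braid.transport (x, y))"

definition \<sigma> :: "'a remnant_quot \<Rightarrow> 'a remnant_quot \<Rightarrow> 'a remnant_quot"
  where "\<sigma> x y = snd (braid.transport (x, y))"

lemma transport_eq: "braid.transport (x, y) = (\<gamma> x y, \<sigma> x y)"
  by (simp add: \<gamma>_def \<sigma>_def)

lemma \<sigma>_\<gamma>_closed: "x \<in> remnant \<Longrightarrow> y \<in> remnant \<Longrightarrow> \<sigma> x y \<in> remnant"
  "x \<in> remnant \<Longrightarrow> y \<in> remnant \<Longrightarrow> \<gamma> x y \<in> remnant"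
  using braid.transport_in[of "(x, y)"] by (auto simp: transport_eq)

text \<open>The functional \<open>(\<chi> u \<otimes> \<chi> v) \<Gamma>\<close>.\<close>

definition conj_pair :: "'a remnant_quot \<Rightarrow> 'a remnant_quot \<Rightarrow> 'a \<times> 'a \<Rightarrow> bool"
  where "conj_pair u v = Rfun \<star>\<^bsub>sw2\<^esub> prod_fun (\<chi> v) (\<chi> u) \<star>\<^bsub>sw2\<^esub> Rinvfun"

lemma conj_pair_iff:
  assumes "u \<in> remnant" "v \<in> remnant"
  shows "conj_pair u v (a, b) \<longleftrightarrow> (\<exists>x\<in>remnant. \<exists>y\<in>remnant. \<chi> x a \<and> \<chi> y b \<and> \<sigma> x y = u \<and> \<gamma> x y = v)"
  using braid.conj_chi[of "(v, u)" "(a, b)"] assms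
  by (auto simp: conj_pair_def prod_fun_apply transport_eq)

lemma conj_pair_incl_iff:
  assumes "u \<in> remnant" "v \<in> remnant" "x \<in> remnant" "y \<in> remnant"
  shows "conj_pair u v (incl x, incl y) \<longleftrightarrow> \<sigma> x y = u \<and> \<gamma> x y = v"
  using braid.conj_rep_iff[of "(x, y)" "(v, u)"] assms
  by (auto simp: conj_pair_def transport_eq)

text \<open>The functional \<open>(\<chi> u \<otimes> \<epsilon>) \<Gamma>\<close>, which by \<open>conj_char_iff\<close> is the set of pairs \<open>(x, y)\<close> with
  \<open>\<sigma> x y = u\<close>.\<close>

definition conj_char :: "'a remnant_quot \<Rightarrow> 'a \<times> 'a \<Rightarrow> bool"
  where "conj_char u = Rfun \<star>\<^bsub>sw2\<^esub> prod_fun counit (\<chi> u) \<star>\<^bsub>sw2\<^esub> Rinvfun"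

lemma conj_char_iff:
  assumes "u \<in> remnant"
  shows "conj_char u (a, b) \<longleftrightarrow> (\<exists>x\<in>remnant. \<exists>y\<in>remnant. \<chi> x a \<and> \<chi> y b \<and> \<sigma> x y = u)"
proof -
  have "prod_fun counit (\<chi> u) = (\<lambda>p. \<exists>v\<in>remnant. prod_fun (\<chi> v) (\<chi> u) p)"
    by (auto simp: prod_fun_apply fun_eq_iff counit_iff_chi)
  then have "conj_char u (a, b) \<longleftrightarrow> (\<exists>v\<in>remnant. conj_pair u v (a, b))"
    unfolding conj_char_def conj_pair_def by (simp only: H2.conj_Ex)
  then show ?thesis using conj_pair_iff[OF assms] \<sigma>_\<gamma>_closed by (simp cong: bex_cong) blast
qed

lemma counit_char_functional: "u \<in> remnant \<Longrightarrow> prod_fun counit (\<chi> u) \<in> JP2"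
  unfolding functionals2_iff prod_fun_def prod.case by (intro conjI allI join_preserving_and join_preserving_chi counit_join)

lemma functionals3_intros:
  "join_preserving g \<Longrightarrow> F \<in> JP2 \<Longrightarrow> prod_fun g F \<in> JP3"
  "join_preserving g \<Longrightarrow> F \<in> JP2 \<Longrightarrow> middle_fun g F \<in> JP3"
  "join_preserving g \<Longrightarrow> F \<in> JP2 \<Longrightarrow> last_fun g F \<in> JP3"
  unfolding functionals3_iff functionals2_iff prod_fun_def middle_fun_def last_fun_def prod.case
  by (intro conjI allI join_preserving_and; simp)+

section \<open>The braiding axioms on the remnant\<close>

text \<open>Functionals are pulled back along the product of \<open>H\<close> in one of their variables. Since the
  coproduct is multiplicative, both pullbacks are homomorphisms for convolution.\<close>

definition pull_left :: "('a \<times> 'a \<Rightarrow> bool) \<Rightarrow> 'a \<times> 'a \<times> 'a \<Rightarrow> bool"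
  where "pull_left F = (\<lambda>(a, b, c). F (a \<cdot> b, c))"

definition pull_right :: "('a \<times> 'a \<Rightarrow> bool) \<Rightarrow> 'a \<times> 'a \<times> 'a \<Rightarrow> bool"
  where "pull_right F = (\<lambda>(a, b, c). F (a, b \<cdot> c))"

lemma pull_functional: "F \<in> JP2 \<Longrightarrow> pull_left F \<in> JP3" "F \<in> JP2 \<Longrightarrow> pull_right F \<in> JP3"
  unfolding functionals3_iff functionals2_iff pull_left_def pull_right_def prod.case
  by (intro conjI allI; (erule conjE)?; (drule spec)?;
      (assumption | erule spec | erule join_preserving_comp[OF _ join_preserving_hprod(1)]
        | erule join_preserving_comp[OF _ join_preserving_hprod(2)] | blast intro: join_preserving_comp join_preserving_hprod))+

lemma pull_counit: "pull_left (prod_fun counit counit) = prod_fun counit (prod_fun counit counit)"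
  "pull_right (prod_fun counit counit) = prod_fun counit (prod_fun counit counit)"
  by (auto simp: pull_left_def pull_right_def prod_fun_apply fun_eq_iff counit_hmult)

lemma join_preserving_ex_sw_param: "(\<And>b c. join_preserving (\<lambda>x. F x b c)) \<Longrightarrow>
    join_preserving (\<lambda>x :: 'a. \<exists>b c. (b, c) \<in> sw h \<and> F x b c)"
  unfolding ex_sw by (rule join_preserving_lift_param) simp

lemma conv_pull_left:
  assumes "F \<in> JP2" "G \<in> JP2"
  shows "pull_left F \<star>\<^bsub>sw3\<^esub> pull_left G = pull_left (F \<star>\<^bsub>sw2\<^esub> G)"
proof (rule ext, clarify)
  fix a b c
  have J: "join_preserving (\<lambda>a. F (a, b))" "join_preserving (\<lambda>a. G (a, b))" for b
    using assms by (auto simp: functionals2_iff)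
  show "(pull_left F \<star>\<^bsub>sw3\<^esub> pull_left G) (a, b, c) = pull_left (F \<star>\<^bsub>sw2\<^esub> G) (a, b, c)"
    unfolding conv_prod_split3 pull_left_def prod.case
    unfolding conv_prod_split
    by (subst sw_hprod; (rule refl | intro join_preserving_ex_sw_param join_preserving_and J))
qed

lemma conv_pull_right:
  assumes "F \<in> JP2" "G \<in> JP2"
  shows "pull_right F \<star>\<^bsub>sw3\<^esub> pull_right G = pull_right (F \<star>\<^bsub>sw2\<^esub> G)"
proof (rule ext, clarify)
  fix a b c
  have J: "join_preserving (\<lambda>b. F (a, b))" "join_preserving (\<lambda>b. G (a, b))" for a
    using assms by (auto simp: functionals2_iff)
  show "(pull_right F \<star>\<^bsub>sw3\<^esub> pull_right G) (a, b, c) = pull_right (F \<star>\<^bsub>sw2\<^esub> G) (a, b, c)"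
    unfolding conv_prod_split3 pull_right_def prod.case
    unfolding conv_prod_split
    by (subst sw_hprod; (rule refl | intro join_preserving_ex_sw_param join_preserving_and J))
qed

abbreviation "R12 \<equiv> last_fun counit Rfun"
abbreviation "R13 \<equiv> middle_fun counit Rfun"
abbreviation "R23 \<equiv> prod_fun counit Rfun"
abbreviation "V12 \<equiv> last_fun counit Rinvfun"
abbreviation "V13 \<equiv> middle_fun counit Rinvfun"
abbreviation "V23 \<equiv> prod_fun counit Rinvfun"

lemma legs_functional: "R12 \<in> JP3" "R13 \<in> JP3" "R23 \<in> JP3" "V12 \<in> JP3" "V13 \<in> JP3" "V23 \<in> JP3"
  by (intro functionals3_intros counit_join Rfun_functional)+

lemma counit_conv: "counit \<star>\<^bsub>sw\<^esub> counit = counit"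
  by (rule H.conv_eps) (simp add: counit_join)

lemma chi_conv: "u \<in> remnant \<Longrightarrow> counit \<star>\<^bsub>sw\<^esub> \<chi> u = \<chi> u" "u \<in> remnant \<Longrightarrow> \<chi> u \<star>\<^bsub>sw\<^esub> counit = \<chi> u"
  by (rule H.conv_eps, simp add: join_preserving_chi)+

lemma legs_inverse: "R12 \<star>\<^bsub>sw3\<^esub> V12 = prod_fun counit (prod_fun counit counit)"
  "R13 \<star>\<^bsub>sw3\<^esub> V13 = prod_fun counit (prod_fun counit counit)"
  "R23 \<star>\<^bsub>sw3\<^esub> V23 = prod_fun counit (prod_fun counit counit)"
  unfolding conv_last_fun conv_middle_fun conv_prod_fun counit_conv Rfun_inverse
  by (auto simp: last_fun_def middle_fun_def prod_fun_apply fun_eq_iff)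

lemma pull_left_Rfun: "pull_left Rfun = R23 \<star>\<^bsub>sw3\<^esub> R13"
proof (rule ext, clarify)
  fix a b c
  have J: "join_preserving (\<lambda>a. Rfun (a, b))" for b using Rfun_functional by (simp add: functionals2_iff)
  have "(R23 \<star>\<^bsub>sw3\<^esub> R13) (a, b, c) \<longleftrightarrow>
    (\<exists>c1 c2. (c1, c2) \<in> sw c \<and> (\<exists>b1 b2. (b1, b2) \<in> sw b \<and> Rfun (b1, c1) \<and> counit b2) \<and>
      (\<exists>a1 a2. (a1, a2) \<in> sw a \<and> counit a1 \<and> Rfun (a2, c2)))"
    unfolding conv_prod_split3 prod_fun_def middle_fun_def prod.case by blast
  then show "pull_left Rfun (a, b, c) = (R23 \<star>\<^bsub>sw3\<^esub> R13) (a, b, c)"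
    by (simp add: sw_counit[OF J] pull_left_def Rfun_mult_left)
qed

lemma pull_right_Rfun: "pull_right Rfun = R12 \<star>\<^bsub>sw3\<^esub> R13"
proof (rule ext, clarify)
  fix a b c
  have J: "join_preserving (\<lambda>b. Rfun (a, b))" for a using Rfun_functional by (simp add: functionals2_iff)
  have "(R12 \<star>\<^bsub>sw3\<^esub> R13) (a, b, c) \<longleftrightarrow>
    (\<exists>a1 a2. (a1, a2) \<in> sw a \<and> (\<exists>b1 b2. (b1, b2) \<in> sw b \<and> Rfun (a1, b1) \<and> counit b2) \<and>
      (\<exists>c1 c2. (c1, c2) \<in> sw c \<and> counit c1 \<and> Rfun (a2, c2)))"
    unfolding conv_prod_split3 last_fun_def middle_fun_def prod.case by blast
  then show "pull_right Rfun (a, b, c) = (R12 \<star>\<^bsub>sw3\<^esub> R13) (a, b, c)"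
    by (simp add: sw_counit[OF J] pull_right_def Rfun_mult_right)
qed

text \<open>The inverse of a convolution product is the product of the inverses in reverse order.\<close>

lemma pull_left_Rinvfun: "pull_left Rinvfun = V13 \<star>\<^bsub>sw3\<^esub> V23"
proof (rule H3.inverse_unique[of "pull_left Rfun"])
  show "pull_left Rinvfun \<star>\<^bsub>sw3\<^esub> pull_left Rfun = prod_fun counit (prod_fun counit counit)"
    by (simp add: conv_pull_left Rfun_functional Rfun_inverse pull_counit)
  show "pull_left Rfun \<star>\<^bsub>sw3\<^esub> (V13 \<star>\<^bsub>sw3\<^esub> V23) = prod_fun counit (prod_fun counit counit)"
    unfolding pull_left_Rfun by (intro H3.inverse_mult legs_functional legs_inverse)
qed (intro pull_functional H3.J_conv legs_functional Rfun_functional)+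

lemma pull_right_Rinvfun: "pull_right Rinvfun = V13 \<star>\<^bsub>sw3\<^esub> V12"
proof (rule H3.inverse_unique[of "pull_right Rfun"])
  show "pull_right Rinvfun \<star>\<^bsub>sw3\<^esub> pull_right Rfun = prod_fun counit (prod_fun counit counit)"
    by (simp add: conv_pull_right Rfun_functional Rfun_inverse pull_counit)
  show "pull_right Rfun \<star>\<^bsub>sw3\<^esub> (V13 \<star>\<^bsub>sw3\<^esub> V12) = prod_fun counit (prod_fun counit counit)"
    unfolding pull_right_Rfun by (intro H3.inverse_mult legs_functional legs_inverse)
qed (intro pull_functional H3.J_conv legs_functional Rfun_functional)+

text \<open>Pull back the conjugate of \<open>\<epsilon> \<otimes> \<chi> u\<close> along \<open>(a, b, c) \<mapsto> (a.b, c)\<close>. The pullback of \<open>R\<close> is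
  \<open>R\<^sub>2\<^sub>3 \<star> R\<^sub>1\<^sub>3\<close>, so it amounts to conjugating first on the legs 1 and 3, which replaces \<open>\<chi> u\<close> on
  the third leg by \<open>\<chi> s\<close> on the first and \<open>\<chi> w\<close> on the third leg with \<open>\<sigma> s w = u\<close>, and then
  on the legs 2 and 3.\<close>

lemma \<sigma>_action:
  assumes xyz: "x \<in> remnant" "y \<in> remnant" "z \<in> remnant"
  shows "\<sigma> (x \<odot> y) z = \<sigma> x (\<sigma> y z)"
proof -
  define u where "u = \<sigma> (x \<odot> y) z"
  have u: "u \<in> remnant" unfolding u_def by (intro \<sigma>_\<gamma>_closed remnant_mult xyz)
  let ?X = "\<lambda>u. prod_fun counit (\<chi> u)"
  have "conj_char u (incl x \<cdot> incl y, incl z)"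
    unfolding conj_char_iff[OF u] using xyz remnant_mult[OF xyz(1,2)]
    by (auto simp: chi_hprod chi_incl u_def intro!: bexI[of _ "x \<odot> y"] bexI[of _ z] bexI[of _ x] bexI[of _ y])
  then have "pull_left (conj_char u) (incl x, incl y, incl z)" by (simp add: pull_left_def)
  also have "pull_left (conj_char u) = pull_left Rfun \<star>\<^bsub>sw3\<^esub> pull_left (?X u) \<star>\<^bsub>sw3\<^esub> pull_left Rinvfun"
    unfolding conj_char_def by (simp add: conv_pull_left Rfun_functional counit_char_functional u H2.J_conv)
  also have "pull_left (?X u) = middle_fun counit (?X u)"
    by (auto simp: pull_left_def middle_fun_def prod_fun_apply fun_eq_iff counit_hmult)
  also have "pull_left Rfun \<star>\<^bsub>sw3\<^esub> \<dots> \<star>\<^bsub>sw3\<^esub> pull_left Rinvfun =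
      R23 \<star>\<^bsub>sw3\<^esub> (R13 \<star>\<^bsub>sw3\<^esub> middle_fun counit (?X u) \<star>\<^bsub>sw3\<^esub> V13) \<star>\<^bsub>sw3\<^esub> V23"
    unfolding pull_left_Rfun pull_left_Rinvfun by (intro H3.conj_conj legs_functional functionals3_intros counit_char_functional u counit_join)
  also have "R13 \<star>\<^bsub>sw3\<^esub> middle_fun counit (?X u) \<star>\<^bsub>sw3\<^esub> V13 = middle_fun counit (conj_char u)"
    unfolding conv_middle_fun counit_conv conj_char_def ..
  also have "middle_fun counit (conj_char u) =
      (\<lambda>p. \<exists>(s, w)\<in>{(s, w). s \<in> remnant \<and> w \<in> remnant \<and> \<sigma> s w = u}. prod_fun (\<chi> s) (?X w) p)"
    by (auto simp: middle_fun_def prod_fun_apply fun_eq_iff conj_char_iff[OF u])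
  finally have "\<exists>(s, w)\<in>{(s, w). s \<in> remnant \<and> w \<in> remnant \<and> \<sigma> s w = u}.
      (R23 \<star>\<^bsub>sw3\<^esub> prod_fun (\<chi> s) (?X w) \<star>\<^bsub>sw3\<^esub> V23) (incl x, incl y, incl z)"
    by (simp only: H3.conj_Ex case_prod_beta case_prod_beta')
  then obtain s w where sw: "s \<in> remnant" "w \<in> remnant" "\<sigma> s w = u"
    and "(R23 \<star>\<^bsub>sw3\<^esub> prod_fun (\<chi> s) (?X w) \<star>\<^bsub>sw3\<^esub> V23) (incl x, incl y, incl z)"
    by blast
  then have "\<chi> s (incl x)" "conj_char w (incl y, incl z)"
    by (simp_all add: conv_prod_fun chi_conv flip: conj_char_def) (simp_all add: prod_fun_apply)
  then have "s = x" "\<sigma> y z = w"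
    using xyz sw by (auto simp: chi_incl conj_char_iff)
  then show ?thesis using sw u_def by simp
qed

text \<open>The same with the pullback along \<open>(a, b, c) \<mapsto> (a, b.c)\<close>, under which \<open>R\<close> becomes
  \<open>R\<^sub>1\<^sub>2 \<star> R\<^sub>1\<^sub>3\<close> and \<open>\<chi> u\<close> the join of \<open>\<chi> v \<otimes> \<chi> w\<close> over all factorizations of \<open>u\<close>. In the last
  conjugation both components of the braiding operator occur.\<close>

lemma \<sigma>_hexagon:
  assumes xyz: "x \<in> remnant" "y \<in> remnant" "z \<in> remnant"
  shows "\<sigma> x (y \<odot> z) = \<sigma> x y \<odot> \<sigma> (\<gamma> x y) z"
proof -
  define u where "u = \<sigma> x (y \<odot> z)"
  have u: "u \<in> remnant" unfolding u_def by (intro \<sigma>_\<gamma>_closed remnant_mult xyz)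
  let ?X = "\<lambda>u. prod_fun counit (\<chi> u)"
  have "conj_char u (incl x, incl y \<cdot> incl z)"
    unfolding conj_char_iff[OF u] using xyz remnant_mult[OF xyz(2,3)]
    by (auto simp: chi_hprod chi_incl u_def intro!: bexI[of _ "y \<odot> z"] bexI[of _ z] bexI[of _ x] bexI[of _ y])
  then have "pull_right (conj_char u) (incl x, incl y, incl z)" by (simp add: pull_right_def)
  also have "pull_right (conj_char u) = pull_right Rfun \<star>\<^bsub>sw3\<^esub> pull_right (?X u) \<star>\<^bsub>sw3\<^esub> pull_right Rinvfun"
    unfolding conj_char_def by (simp add: conv_pull_right Rfun_functional counit_char_functional u H2.J_conv)
  also have "pull_right (?X u) =
      (\<lambda>p. \<exists>(v, w)\<in>{(v, w). v \<in> remnant \<and> w \<in> remnant \<and> v \<odot> w = u}. middle_fun (\<chi> v) (?X w) p)"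
    by (auto simp: pull_right_def middle_fun_def prod_fun_apply fun_eq_iff chi_hprod[OF u])
  finally have "\<exists>(v, w)\<in>{(v, w). v \<in> remnant \<and> w \<in> remnant \<and> v \<odot> w = u}.
      (pull_right Rfun \<star>\<^bsub>sw3\<^esub> middle_fun (\<chi> v) (?X w) \<star>\<^bsub>sw3\<^esub> pull_right Rinvfun) (incl x, incl y, incl z)"
    by (simp only: H3.conj_Ex case_prod_beta case_prod_beta')
  then obtain v w where vw: "v \<in> remnant" "w \<in> remnant" "v \<odot> w = u"
    and "(pull_right Rfun \<star>\<^bsub>sw3\<^esub> middle_fun (\<chi> v) (?X w) \<star>\<^bsub>sw3\<^esub> pull_right Rinvfun) (incl x, incl y, incl z)"
    by blast
  note this(4)
  also have "pull_right Rfun \<star>\<^bsub>sw3\<^esub> middle_fun (\<chi> v) (?X w) \<star>\<^bsub>sw3\<^esub> pull_right Rinvfun =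
      R12 \<star>\<^bsub>sw3\<^esub> (R13 \<star>\<^bsub>sw3\<^esub> middle_fun (\<chi> v) (?X w) \<star>\<^bsub>sw3\<^esub> V13) \<star>\<^bsub>sw3\<^esub> V12"
    unfolding pull_right_Rfun pull_right_Rinvfun by (intro H3.conj_conj legs_functional functionals3_intros counit_char_functional join_preserving_chi vw)
  also have "R13 \<star>\<^bsub>sw3\<^esub> middle_fun (\<chi> v) (?X w) \<star>\<^bsub>sw3\<^esub> V13 = middle_fun (\<chi> v) (conj_char w)"
    using vw by (simp add: conv_middle_fun chi_conv conj_char_def)
  also have "middle_fun (\<chi> v) (conj_char w) =
      (\<lambda>p. \<exists>(s, t)\<in>{(s, t). s \<in> remnant \<and> t \<in> remnant \<and> \<sigma> s t = w}.
        last_fun (\<chi> t) (prod_fun (\<chi> s) (\<chi> v)) p)"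
    by (auto simp: middle_fun_def last_fun_def prod_fun_apply fun_eq_iff conj_char_iff[OF vw(2)])
  finally have "\<exists>(s, t)\<in>{(s, t). s \<in> remnant \<and> t \<in> remnant \<and> \<sigma> s t = w}.
      (R12 \<star>\<^bsub>sw3\<^esub> last_fun (\<chi> t) (prod_fun (\<chi> s) (\<chi> v)) \<star>\<^bsub>sw3\<^esub> V12) (incl x, incl y, incl z)"
    by (simp only: H3.conj_Ex case_prod_beta case_prod_beta')
  then obtain s t where st: "s \<in> remnant" "t \<in> remnant" "\<sigma> s t = w"
    and "(R12 \<star>\<^bsub>sw3\<^esub> last_fun (\<chi> t) (prod_fun (\<chi> s) (\<chi> v)) \<star>\<^bsub>sw3\<^esub> V12) (incl x, incl y, incl z)"
    by blast
  then have "\<chi> t (incl z)" "conj_pair v s (incl x, incl y)"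
    by (simp_all add: conv_last_fun chi_conv flip: conj_pair_def) (simp_all add: last_fun_def)
  then have "t = z" "\<sigma> x y = v" "\<gamma> x y = s"
    using xyz st vw by (simp_all add: chi_incl conj_pair_incl_iff)
  then show ?thesis using st vw u_def by simp
qed

lemma join_preserving_SUP_act:
  assumes "join_preserving F"
  shows "F (SUP (a1, a2)\<in>A. SUP (b1, b2)\<in>B. act (p a1 a2 b1 b2) (h a1 a2 b1 b2)) \<longleftrightarrow>
    (\<exists>a1 a2. (a1, a2) \<in> A \<and> (\<exists>b1 b2. (b1, b2) \<in> B \<and> p a1 a2 b1 b2 \<and> F (h a1 a2 b1 b2)))"
proof -
  have act: "F (act q k) \<longleftrightarrow> q \<and> F k" for q k
    using join_preserving_bot[OF assms] by (simp add: act_def)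
  have SUP: "F (SUP (a, b)\<in>C. k a b) \<longleftrightarrow> (\<exists>a b. (a, b) \<in> C \<and> F (k a b))" for k and C :: "('x \<times> 'y) set"
    using assms unfolding join_preserving_bool_iff by (simp add: Bex_def)
  show ?thesis by (simp add: act SUP)
qed

text \<open>Braided commutativity, tested with a character, says that conjugation by \<open>R\<close> takes
  \<open>\<chi> w (b.a)\<close> to \<open>\<chi> w (a.b)\<close>.\<close>

lemma \<sigma>_\<gamma>_product:
  assumes xy: "x \<in> remnant" "y \<in> remnant"
  shows "\<sigma> x y \<odot> \<gamma> x y = x \<odot> y"
proof -
  let ?w = "\<sigma> x y \<odot> \<gamma> x y"
  have w: "?w \<in> remnant" by (intro remnant_mult \<sigma>_\<gamma>_closed xy)
  let ?M = "\<lambda>(a, b). \<chi> ?w (a \<cdot> b)" and ?N = "\<lambda>(a, b). \<chi> ?w (b \<cdot> a)"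
  have MJ: "?M \<in> JP2"
    unfolding functionals2_iff prod.case
    by (intro conjI allI join_preserving_comp[OF join_preserving_chi[OF w]] join_preserving_hprod)
  have "Rfun \<star>\<^bsub>sw2\<^esub> ?N = ?M \<star>\<^bsub>sw2\<^esub> Rfun"
  proof (rule ext, clarify)
    fix b a
    have "(SUP (a1, a2)\<in>sw a. SUP (b1, b2)\<in>sw b. act (R (b1 \<boxtimes> a1)) (a2 \<cdot> b2)) =
           (SUP (a1, a2)\<in>sw a. SUP (b1, b2)\<in>sw b. act (R (b2 \<boxtimes> a2)) (b1 \<cdot> a1))"
      using cqt unfolding coquasitriangular_def by blast
    then have "\<chi> ?w (SUP (a1, a2)\<in>sw a. SUP (b1, b2)\<in>sw b. act (R (b1 \<boxtimes> a1)) (a2 \<cdot> b2)) =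
           \<chi> ?w (SUP (a1, a2)\<in>sw a. SUP (b1, b2)\<in>sw b. act (R (b2 \<boxtimes> a2)) (b1 \<cdot> a1))"
      by simp
    then show "(Rfun \<star>\<^bsub>sw2\<^esub> ?N) (b, a) = (?M \<star>\<^bsub>sw2\<^esub> Rfun) (b, a)"
      unfolding join_preserving_SUP_act[OF join_preserving_chi[OF w]] conv_prod_split Rfun_def prod.case by blast
  qed
  then have N: "Rfun \<star>\<^bsub>sw2\<^esub> ?N \<star>\<^bsub>sw2\<^esub> Rinvfun = ?M"
    by (simp add: H2.conv_assoc MJ Rfun_functional Rfun_inverse H2.conv_eps)
  have "?N p" if "prod_fun (\<chi> (\<gamma> x y)) (\<chi> (\<sigma> x y)) p" for p
  proof (cases p)
    case (Pair a b)
    then show ?thesis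
      using that \<sigma>_\<gamma>_closed[OF xy] unfolding Pair prod.case chi_hprod[OF w] prod_fun_apply by blast
  qed
  moreover have "conj_pair (\<sigma> x y) (\<gamma> x y) (incl x, incl y)"
    using xy \<sigma>_\<gamma>_closed by (simp add: conj_pair_incl_iff)
  ultimately have "(Rfun \<star>\<^bsub>sw2\<^esub> ?N \<star>\<^bsub>sw2\<^esub> Rinvfun) (incl x, incl y)"
    unfolding conj_pair_def conv_def by blast
  then have "\<chi> ?w (incl x \<cdot> incl y)" unfolding N by simp
  then show ?thesis using xy by (auto simp: chi_hprod[OF w] chi_incl)
qed

text \<open>The coproduct of the unit has, besides the terms below \<open>(1, 1)\<close>, those with a bottom
  component. The latter do not contribute to expressions in \<open>R\<close> and its inverse, which are \<open>False\<close>
  as soon as one argument is bottom.\<close>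

lemma sw_hone:
  assumes "(a, b) \<in> sw h" "h \<le> hone"
  shows "a = bot \<or> b = bot \<or> a \<le> hone \<and> b \<le> hone"
proof -
  have "comult h \<le> hone \<boxtimes> hone"
    using join_preserving_mono[OF comult_join assms(2)] by (simp add: comult_hone)
  then have "(a, b) \<in> terms (hone \<boxtimes> hone)"
    using assms(1) by (auto simp: sweedler2_def less_eq_tensor.rep_eq)
  then show ?thesis by (auto simp: terms_pure)
qed

lemma Rfun_bot: "\<not> Rfun (bot, b)" "\<not> Rfun (a, bot)" "\<not> Rinvfun (bot, b)" "\<not> Rinvfun (a, bot)"
  using join_preserving_bot[OF R_join_preserving(1)] join_preserving_bot[OF R_join_preserving(2)]
  by (simp_all add: Rfun_def Rinvfun_def pure_tensor_bot)

lemma chi_bot: "u \<in> remnant \<Longrightarrow> \<not> \<chi> u bot"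
  using join_preserving_bot[OF join_preserving_chi] by simp

lemma remnant_one: "quot_one \<in> remnant"
  using remnant_iff_invertible quot_mult_one by blast

lemma chi_le_hone: "u \<in> remnant \<Longrightarrow> \<chi> u a \<Longrightarrow> a \<le> hone \<Longrightarrow> u = quot_one"
  using chi_hone proj_mono unfolding \<chi>_def by (meson order_trans)

lemma conj_pair_unfold: "conj_pair u v (a, b) \<longleftrightarrow> (\<exists>a' a3 b' b3 a1 a2 b1 b2. (a', a3) \<in> sw a \<and> (b', b3) \<in> sw b \<and>
    (a1, a2) \<in> sw a' \<and> (b1, b2) \<in> sw b' \<and> Rfun (a1, b1) \<and> \<chi> v a2 \<and> \<chi> u b2 \<and> Rinvfun (a3, b3))"
  unfolding conj_pair_def conv_prod_split prod_fun_def prod.case by blast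

text \<open>The unit \<open>hone\<close> of \<open>H\<close> represents the unit of the remnant, and the components of its iterated
  coproduct at which the characters are evaluated lie below it.\<close>

lemma \<gamma>_one:
  assumes "y \<in> remnant"
  shows "\<gamma> quot_one y = quot_one"
proof -
  note c = \<sigma>_\<gamma>_closed[OF remnant_one assms]
  have "conj_pair (\<sigma> quot_one y) (\<gamma> quot_one y) (hone, incl y)"
    unfolding conj_pair_iff[OF c] using assms remnant_one by (auto simp: chi_hone chi_incl)
  then obtain a' a3 b' b3 a1 a2 b1 b2 where *: "(a', a3) \<in> sw hone" "(a1, a2) \<in> sw a'"
    "Rfun (a1, b1)" "\<chi> (\<gamma> quot_one y) a2" "Rinvfun (a3, b3)"
    unfolding conj_pair_unfold by blast
  have "a' \<le> hone" using sw_hone[OF *(1)] *(5) Rfun_bot by auto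
  then have "a2 \<le> hone" using sw_hone[OF *(2)] *(3) Rfun_bot by auto
  then show ?thesis using chi_le_hone c *(4) by blast
qed

lemma \<sigma>_one_left: "y \<in> remnant \<Longrightarrow> \<sigma> quot_one y = y"
  using \<sigma>_\<gamma>_product[OF remnant_one, of y] by (simp add: \<gamma>_one quot_mult_one)

lemma \<sigma>_one_right:
  assumes "x \<in> remnant"
  shows "\<sigma> x quot_one = quot_one"
proof -
  note c = \<sigma>_\<gamma>_closed[OF assms remnant_one]
  have "conj_pair (\<sigma> x quot_one) (\<gamma> x quot_one) (incl x, hone)"
    unfolding conj_pair_iff[OF c] using assms remnant_one by (auto simp: chi_hone chi_incl)
  then obtain a' a3 b' b3 a1 a2 b1 b2 where *: "(b', b3) \<in> sw hone" "(b1, b2) \<in> sw b'"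
    "Rfun (a1, b1)" "\<chi> (\<sigma> x quot_one) b2" "Rinvfun (a3, b3)"
    unfolding conj_pair_unfold by blast
  have "b' \<le> hone" using sw_hone[OF *(1)] *(5) Rfun_bot by auto
  then have "b2 \<le> hone" using sw_hone[OF *(2)] *(3) Rfun_bot by auto
  then show ?thesis using chi_le_hone c *(4) by blast
qed

section \<open>The transmuted product on the remnant\<close>

text \<open>The functional \<open>R(_, 1)\<close> is idempotent because \<open>1 . 1 = 1\<close>, and it has \<open>Rinv(_, 1)\<close> as a
  right inverse, so it is the unit of the convolution monoid.\<close>

lemma Rfun_hone: "Rfun (a, hone) \<longleftrightarrow> counit a"
proof -
  let ?f = "\<lambda>a. Rfun (a, hone)" and ?f' = "\<lambda>a. Rinvfun (a, hone)"
  have J: "?f \<in> JP" "?f' \<in> JP" using Rfun_functional by (auto simp: functionals2_iff)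
  have "?f \<star>\<^bsub>sw\<^esub> ?f = ?f"
    unfolding conv_def
    by (rule ext) (rule Rfun_mult_right[of _ hone hone, unfolded hmult_hone_left, symmetric])
  moreover have "?f \<star>\<^bsub>sw\<^esub> ?f' = counit"
  proof
    fix a
    have "(hone, hone) \<in> sw hone" by (simp add: sweedler2_def comult_hone terms_pure)
    moreover have "Rfun (a1, b1) \<and> Rinvfun (a2, b2) \<Longrightarrow> Rfun (a1, hone) \<and> Rinvfun (a2, hone)"
      if "(b1, b2) \<in> sw hone" for a1 a2 b1 b2
    proof -
      assume RV: "Rfun (a1, b1) \<and> Rinvfun (a2, b2)"
      then have "b1 \<le> hone" "b2 \<le> hone" using sw_hone[OF that] Rfun_bot by auto
      moreover have "join_preserving (\<lambda>b. Rfun (a1, b))" "join_preserving (\<lambda>b. Rinvfun (a2, b))"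
        using Rfun_functional by (auto simp: functionals2_iff)
      ultimately show ?thesis using RV join_preserving_mono by (metis le_boolD)
    qed
    ultimately have "(?f \<star>\<^bsub>sw\<^esub> ?f') a \<longleftrightarrow> (Rfun \<star>\<^bsub>sw2\<^esub> Rinvfun) (a, hone)"
      unfolding conv_prod_split unfolding conv_def by blast
    then show "(?f \<star>\<^bsub>sw\<^esub> ?f') a \<longleftrightarrow> counit a"
      by (simp add: Rfun_inverse prod_fun_apply counit_hone)
  qed
  ultimately have "?f = counit"
    using H.conv_assoc[OF J(1,1,2)] H.conv_eps(2)[OF J(1)] by simp
  then show ?thesis by (rule fun_cong)
qed

text \<open>As \<open>R\<close> is multiplicative in its second variable, convolving \<open>R(a, b)\<close> with \<open>R(a, S b)\<close>
  gives \<open>R(a, b\<^sub>1 . S b\<^sub>2) = R(a, 1) \<epsilon>(b)\<close>. So \<open>R(a, S b)\<close> is a right inverse of \<open>R\<close>.\<close>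

lemma Rinvfun_antipode: "Rinvfun (a, b) \<longleftrightarrow> Rfun (a, antipode b)"
proof -
  let ?W = "\<lambda>(a, b). Rfun (a, antipode b)"
  have J: "join_preserving (\<lambda>b. Rfun (a, b))" "join_preserving (\<lambda>a. Rfun (a, b))" for a b
    using Rfun_functional by (auto simp: functionals2_iff)
  have WJ: "?W \<in> JP2"
    unfolding functionals2_iff prod.case by (intro conjI allI J(2) join_preserving_comp[OF J(1) antipode_join])
  have "Rfun \<star>\<^bsub>sw2\<^esub> ?W = prod_fun counit counit"
  proof (rule ext, clarify)
    fix a b
    have "(Rfun \<star>\<^bsub>sw2\<^esub> ?W) (a, b) \<longleftrightarrow> (\<exists>b1 b2. (b1, b2) \<in> sw b \<and> Rfun (a, b1 \<cdot> antipode b2))"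
      unfolding conv_prod_split Rfun_mult_right by auto
    also have "\<dots> \<longleftrightarrow> Rfun (a, SUP (b1, b2)\<in>sw b. b1 \<cdot> antipode b2)"
      using J(1)[of a] unfolding join_preserving_bool_iff by (simp add: Bex_def)
    also have "\<dots> \<longleftrightarrow> counit a \<and> counit b"
      unfolding sw_antipode by (simp add: act_def Rfun_hone Rfun_bot)
    finally show "(Rfun \<star>\<^bsub>sw2\<^esub> ?W) (a, b) = prod_fun counit counit (a, b)"
      by (simp add: prod_fun_apply)
  qed
  then have "Rinvfun = ?W"
    using H2.inverse_unique[of Rfun Rinvfun ?W] Rfun_functional WJ Rfun_inverse by blast
  then show ?thesis by (metis case_prod_conv)
qed

text \<open>Expand \<open>R(a, b\<^sub>1 . S b\<^sub>3)\<close> as \<open>R(a\<^sub>1, b\<^sub>1) R(a\<^sub>2, S b\<^sub>3) = R(a\<^sub>1, b\<^sub>1) Rinv(a\<^sub>2, b\<^sub>3)\<close>.\<close>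

lemma conj_char_sweedler3:
  assumes "v \<in> remnant"
  shows "conj_char v (a, b) \<longleftrightarrow> (\<exists>b1 b2 b3. (b1, b2, b3) \<in> sweedler3 b \<and> Rfun (a, b1 \<cdot> antipode b3) \<and> \<chi> v b2)"
proof -
  have J: "join_preserving (\<lambda>a. Rfun (a, b))" for b
    using Rfun_functional by (auto simp: functionals2_iff)
  have "(Rfun \<star>\<^bsub>sw2\<^esub> prod_fun counit (\<chi> v)) (a', b') \<longleftrightarrow>
      (\<exists>b1 b2. (b1, b2) \<in> sw b' \<and> (\<exists>a1 a2. (a1, a2) \<in> sw a' \<and> Rfun (a1, b1) \<and> counit a2) \<and> \<chi> v b2)" for a' b'
    unfolding conv_prod_split prod_fun_def prod.case by blast
  then have *: "(Rfun \<star>\<^bsub>sw2\<^esub> prod_fun counit (\<chi> v)) (a', b') \<longleftrightarrow>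
      (\<exists>b1 b2. (b1, b2) \<in> sw b' \<and> Rfun (a', b1) \<and> \<chi> v b2)" for a' b'
    by (simp add: sw_counit(2)[OF J])
  show ?thesis
    unfolding conj_char_def conv_prod_split[where G = Rinvfun] * Rinvfun_antipode Rfun_mult_right sweedler3_def mem_Collect_eq prod.case by blast
qed

text \<open>A character of \<open>a\<^sub>1 . b\<^sub>2\<close> splits into characters \<open>\<chi> u\<close> of \<open>a\<^sub>1\<close> and \<open>\<chi> v\<close> of \<open>b\<^sub>2\<close>. By
  \<open>conj_char_sweedler3\<close> the second one, with its coefficient, asks for \<open>x\<close> and \<open>y\<close> with
  \<open>\<sigma> x y = v\<close>, the character \<open>\<chi> x\<close> of \<open>S a\<^sub>2\<close> and \<open>\<chi> y\<close> of \<open>b\<close>. As \<open>\<chi> x\<close> of \<open>S a\<^sub>2\<close> is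
  \<open>\<chi> (inv x)\<close> of \<open>a\<^sub>2\<close>, orthogonality of characters forces \<open>u = inv x\<close>.\<close>

lemma chi_transmuted:
  assumes w: "w \<in> remnant"
  shows "\<chi> w (transmuted_product R a b) \<longleftrightarrow> (\<exists>u\<in>remnant. \<exists>y\<in>remnant.
    \<chi> u a \<and> \<chi> y b \<and> w = u \<odot> \<sigma> (inv\<^bsub>remnant_group\<^esub> u) y)"
proof -
  interpret G: group remnant_group by (rule group_remnant_group)
  have ic: "u \<in> remnant \<Longrightarrow> inv\<^bsub>remnant_group\<^esub> u \<in> remnant" for u
    using G.inv_closed[of u] by (simp add: remnant_group_simps)
  have ii: "u \<in> remnant \<Longrightarrow> inv\<^bsub>remnant_group\<^esub> (inv\<^bsub>remnant_group\<^esub> u) = u" for u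
    using G.inv_inv[of u] by (simp add: remnant_group_simps)
  have SUP: "\<chi> w (SUP (a, b)\<in>C. k a b) \<longleftrightarrow> (\<exists>a b. (a, b) \<in> C \<and> \<chi> w (k a b))" for k and C :: "('x \<times> 'y) set"
    using join_preserving_chi[OF w] unfolding join_preserving_bool_iff by (simp add: Bex_def)
  have SUP3: "\<chi> w (SUP (a, b, c)\<in>C. k a b c) \<longleftrightarrow> (\<exists>a b c. (a, b, c) \<in> C \<and> \<chi> w (k a b c))"
    for k and C :: "('x \<times> 'y \<times> 'z) set"
    using join_preserving_chi[OF w] unfolding join_preserving_bool_iff by (simp add: Bex_def)
  have act: "\<chi> w (act q k) \<longleftrightarrow> q \<and> \<chi> w k" for q k
    using chi_bot[OF w] by (simp add: act_def)
  have "\<chi> w (transmuted_product R a b) \<longleftrightarrow> (\<exists>a1 a2. (a1, a2) \<in> sw a \<and>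
      (\<exists>b1 b2 b3. (b1, b2, b3) \<in> sweedler3 b \<and> Rfun (antipode a2, b1 \<cdot> antipode b3) \<and> \<chi> w (a1 \<cdot> b2)))"
    unfolding transmuted_product_def by (simp add: SUP SUP3 act Rfun_def)
  also have "\<dots> \<longleftrightarrow> (\<exists>u\<in>remnant. \<exists>v\<in>remnant. u \<odot> v = w \<and>
      (\<exists>a1 a2. (a1, a2) \<in> sw a \<and> \<chi> u a1 \<and> conj_char v (antipode a2, b)))"
    by (simp add: chi_hprod[OF w] conj_char_sweedler3) blast
  also have "\<dots> \<longleftrightarrow> (\<exists>u\<in>remnant. \<exists>v\<in>remnant. u \<odot> v = w \<and> (\<exists>x\<in>remnant. \<exists>y\<in>remnant.
      \<chi> y b \<and> \<sigma> x y = v \<and> (\<exists>a1 a2. (a1, a2) \<in> sw a \<and> \<chi> u a1 \<and> \<chi> (inv\<^bsub>remnant_group\<^esub> x) a2)))"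
    by (simp add: conj_char_iff chi_antipode) blast
  also have "\<dots> \<longleftrightarrow> (\<exists>u\<in>remnant. \<exists>v\<in>remnant. u \<odot> v = w \<and> (\<exists>x\<in>remnant. \<exists>y\<in>remnant.
      \<chi> y b \<and> \<sigma> x y = v \<and> u = inv\<^bsub>remnant_group\<^esub> x \<and> \<chi> u a))"
    by (simp add: chi_sw ic cong: bex_cong)
  also have "\<dots> \<longleftrightarrow> (\<exists>u\<in>remnant. \<exists>y\<in>remnant. \<chi> u a \<and> \<chi> y b \<and> w = u \<odot> \<sigma> (inv\<^bsub>remnant_group\<^esub> u) y)"
    using ic ii \<sigma>_\<gamma>_closed(1) by metis
  finally show ?thesis .
qed

lemma quot_eqI: "g \<in> remnant \<Longrightarrow> (\<And>w. w \<in> remnant \<Longrightarrow> w \<le> q \<longleftrightarrow> w = g) \<Longrightarrow> q = g" for q :: "'a remnant_quot"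
  by (subst quot_eq_Sup_remnant) (simp cong: conj_cong)

lemma quot_star_eq:
  assumes "x \<in> remnant" "y \<in> remnant"
  shows "quot_star R x y = x \<odot> \<sigma> (inv\<^bsub>remnant_group\<^esub> x) y"
proof (rule quot_eqI)
  interpret G: group remnant_group by (rule group_remnant_group)
  have ic: "inv\<^bsub>remnant_group\<^esub> x \<in> remnant"
    using G.inv_closed[of x] assms by (simp add: remnant_group_simps)
  show "x \<odot> \<sigma> (inv\<^bsub>remnant_group\<^esub> x) y \<in> remnant"
    by (intro remnant_mult \<sigma>_\<gamma>_closed ic assms)
  show "w \<le> quot_star R x y \<longleftrightarrow> w = x \<odot> \<sigma> (inv\<^bsub>remnant_group\<^esub> x) y" if "w \<in> remnant" for w
    using chi_transmuted[OF that, of "incl x" "incl y"] assms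
    by (auto simp: quot_star_def \<chi>_def[of w] chi_incl)
qed

text \<open>The terms of \<open>\<Gamma>\<close> with coefficient \<open>True\<close> are controlled by the functionals \<open>conj_pair\<close>: at the
  representatives of \<open>x\<close> and \<open>y\<close> only \<open>u = \<sigma> x y\<close>, \<open>v = \<gamma> x y\<close> is attained, which bounds each term
  from above, and some term attains it.\<close>

lemma quot_braiding_eq:
  assumes xy: "x \<in> remnant" "y \<in> remnant"
  shows "quot_braiding R Rinv x y = \<sigma> x y \<boxtimes> \<gamma> x y"
proof -
  let ?S = "\<sigma> x y" and ?C = "\<gamma> x y"
  note c = \<sigma>_\<gamma>_closed[OF xy]
  let ?T = "tensor_map proj proj :: ('a, 'a) tensor \<Rightarrow> _"
  have T: "?T (SUP i\<in>I. k i) = (SUP i\<in>I. ?T (k i))" for k and I :: "'i set"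
    using join_preserving_tensor_map_proj unfolding join_preserving_def by (simp add: image_image)
  have Tact: "?T (act p (l \<boxtimes> m)) = act p (proj l \<boxtimes> proj m)" for p l m
    using join_preserving_bot[OF join_preserving_tensor_map_proj]
      tensor_lift_pure[OF bi_join_preserving_proj_pure]
    by (simp add: act_def tensor_map_def)
  have le: "act (R (a1 \<boxtimes> b1) \<and> Rinv (a3 \<boxtimes> b3)) (proj b2 \<boxtimes> proj a2) \<le> ?S \<boxtimes> ?C"
    if a: "(a1, a2, a3) \<in> sweedler3 (incl x)" and b: "(b1, b2, b3) \<in> sweedler3 (incl y)" for a1 a2 a3 b1 b2 b3
  proof (cases "R (a1 \<boxtimes> b1) \<and> Rinv (a3 \<boxtimes> b3)")
    case True
    have "w = ?S \<and> v = ?C" if "v \<in> remnant" "w \<in> remnant" "\<chi> v a2" "\<chi> w b2" for v w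
    proof -
      have "conj_pair w v (incl x, incl y)"
        unfolding conj_pair_unfold Rfun_def Rinvfun_def prod.case
        using a b that True by (auto simp: sweedler3_def) blast
      then show ?thesis using that xy by (simp add: conj_pair_incl_iff)
    qed
    then have *: "proj b2 = bot \<or> proj a2 = bot \<or> (\<forall>w\<in>remnant. w \<le> proj b2 \<longrightarrow> w = ?S) \<and>
        (\<forall>w\<in>remnant. w \<le> proj a2 \<longrightarrow> w = ?C)"
      using ex_remnant_le[of "proj a2"] ex_remnant_le[of "proj b2"] unfolding \<chi>_def by blast
    have "proj b2 \<boxtimes> proj a2 \<le> ?S \<boxtimes> ?C"
    proof (cases "proj b2 = bot \<or> proj a2 = bot")
      case False
      then have "proj b2 \<le> ?S" "proj a2 \<le> ?C"
        using * by (subst proj_eq_Sup_remnant, intro Sup_least, auto)+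
      then show ?thesis by (simp add: pure_tensor_le_iff terms_pure)
    qed (auto simp: pure_tensor_bot)
    then show ?thesis by (simp add: act_def)
  qed (auto simp: act_def)
  have "conj_pair ?S ?C (incl x, incl y)" using c xy by (simp add: conj_pair_incl_iff)
  then obtain a1 a2 a3 b1 b2 b3 where
    a: "(a1, a2, a3) \<in> sweedler3 (incl x)" and b: "(b1, b2, b3) \<in> sweedler3 (incl y)"
    and RV: "R (a1 \<boxtimes> b1)" "Rinv (a3 \<boxtimes> b3)" and \<chi>: "\<chi> ?C a2" "\<chi> ?S b2"
    unfolding conj_pair_unfold Rfun_def Rinvfun_def prod.case sweedler3_def by blast
  have "quot_braiding R Rinv x y = (SUP (a1, a2, a3)\<in>sweedler3 (incl x). SUP (b1, b2, b3)\<in>sweedler3 (incl y).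
       act (R (a1 \<boxtimes> b1) \<and> Rinv (a3 \<boxtimes> b3)) (proj b2 \<boxtimes> proj a2))"
    unfolding quot_braiding_def Gamma_def by (simp add: T case_prod_beta Tact)
  also have "\<dots> = ?S \<boxtimes> ?C"
  proof (rule antisym)
    show "(SUP (a1, a2, a3)\<in>sweedler3 (incl x). SUP (b1, b2, b3)\<in>sweedler3 (incl y).
       act (R (a1 \<boxtimes> b1) \<and> Rinv (a3 \<boxtimes> b3)) (proj b2 \<boxtimes> proj a2)) \<le> ?S \<boxtimes> ?C"
      using le by (auto intro!: SUP_least)
    have "?S \<boxtimes> ?C \<le> act (R (a1 \<boxtimes> b1) \<and> Rinv (a3 \<boxtimes> b3)) (proj b2 \<boxtimes> proj a2)"
      using RV \<chi> by (simp add: act_def pure_tensor_le_iff terms_pure \<chi>_def)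
    also have "\<dots> \<le> (SUP (a1, a2, a3)\<in>sweedler3 (incl x). SUP (b1, b2, b3)\<in>sweedler3 (incl y).
       act (R (a1 \<boxtimes> b1) \<and> Rinv (a3 \<boxtimes> b3)) (proj b2 \<boxtimes> proj a2))"
      by (rule SUP_upper2[OF a], unfold prod.case, rule SUP_upper2[OF b], simp)
    finally show "?S \<boxtimes> ?C \<le> (SUP (a1, a2, a3)\<in>sweedler3 (incl x). SUP (b1, b2, b3)\<in>sweedler3 (incl y).
       act (R (a1 \<boxtimes> b1) \<and> Rinv (a3 \<boxtimes> b3)) (proj b2 \<boxtimes> proj a2))" .
  qed
  finally show ?thesis .
qed

lemma braiding_op_eq:
  assumes xy: "x \<in> remnant" "y \<in> remnant"
  shows "braiding_op R Rinv (x, y) = (\<sigma> x y, \<gamma> x y)"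
proof -
  have "uv = (\<sigma> x y, \<gamma> x y)"
    if "uv \<in> remnant \<times> remnant" "\<sigma> x y \<boxtimes> \<gamma> x y = fst uv \<boxtimes> snd uv" for uv
    using pure_tensor_inject[OF that(2)] \<sigma>_\<gamma>_closed[OF xy] by (auto simp: remnant_def prod_eq_iff)
  then show ?thesis
    unfolding braiding_op_def prod.case quot_braiding_eq[OF xy]
    using \<sigma>_\<gamma>_closed[OF xy] by (intro the_equality) auto
qed

lemma inv_remnant: "x \<in> remnant \<Longrightarrow> inv\<^bsub>remnant_group\<^esub> x \<in> remnant"
  using group.inv_closed[OF group_remnant_group, of x] by (simp add: remnant_group_simps)

lemma quot_star_closed: "x \<in> remnant \<Longrightarrow> y \<in> remnant \<Longrightarrow> quot_star R x y \<in> remnant"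
  by (simp add: quot_star_eq remnant_mult \<sigma>_\<gamma>_closed inv_remnant)

lemma group_quot_star: "group \<lparr>carrier = remnant, monoid.mult = quot_star R, one = quot_one\<rparr>"
proof -
  let ?S = "\<lparr>carrier = remnant,
    monoid.mult = (\<lambda>x y. x \<odot> \<sigma> (inv\<^bsub>remnant_group\<^esub> x) y), one = quot_one\<rparr>"
  have "group ?S"
    using group.braided_star_group[OF group_remnant_group, of \<sigma> \<gamma>]
    by (simp add: remnant_group_simps \<sigma>_\<gamma>_closed \<sigma>_action \<sigma>_one_left \<sigma>_one_right
        \<sigma>_\<gamma>_product \<sigma>_hexagon)
  \<comment> \<open>The two products agree on the carrier only, so the axioms are transferred one by one.\<close>
  then show ?thesis
    unfolding group_def group_axioms_def monoid_def Units_def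
    by (simp add: quot_star_eq quot_star_closed remnant_mult \<sigma>_\<gamma>_closed inv_remnant subset_iff
        cong: bex_cong)
qed

lemma quot_star_eq_braided_star:
  assumes xy: "x \<in> remnant" "y \<in> remnant"
  shows "quot_star R x y = braided_star remnant quot_mult (braiding_op R Rinv) x y"
proof -
  have eq: "sigma (braiding_op R Rinv) x z = \<sigma> x z" if "z \<in> remnant" for z
    using xy that by (simp add: sigma_def braiding_op_eq)
  have "inv_into remnant (sigma (braiding_op R Rinv) x) y = inv_into remnant (\<sigma> x) y"
    unfolding inv_into_def using eq by (metis (no_types, lifting))
  also have "\<dots> = \<sigma> (inv\<^bsub>remnant_group\<^esub> x) y"
    using group.inv_into_action[OF group_remnant_group, of \<sigma> x y] xy
    by (simp add: remnant_group_simps \<sigma>_\<gamma>_closed \<sigma>_action \<sigma>_one_left)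
  finally show ?thesis using xy by (simp add: braided_star_def quot_star_eq)
qed

end

theorem theorem4p3:
  fixes R Rinv :: "('h::hopf_operations, 'h) tensor \<Rightarrow> bool"
  assumes "hopf_algebra TYPE('h)"
    and "coquasitriangular R Rinv"
  shows "(\<forall>x \<in> remnant. \<forall>y \<in> remnant. quot_star R x y \<in> remnant) \<and>
    (\<exists>e. group \<lparr>carrier = remnant, monoid.mult = quot_star R, one = e\<rparr>) \<and>
    (\<forall>x \<in> remnant. \<forall>y \<in> remnant.
       quot_star R x y = braided_star remnant quot_mult (braiding_op R Rinv) x y)"
proof -
  interpret cqt_hopf_algebra "TYPE('h)" R Rinv
    by (intro cqt_hopf_algebra.intro cqt_hopf_algebra_axioms.intro assms)
  show ?thesis
    using quot_star_closed group_quot_star quot_star_eq_braided_star by blast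
qed

end
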